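(* Let $N\in\mathbb{N}$ and $\xi=\sum_{j=1}^N\delta_{u_j}$ with $\mathbf{u}=(u_1,\dots,u_N)\in\mathbb{Z}^N$, $u_1<\cdots<u_N$. Let $0\le t\le T<\infty$. Then for every bounded function $F$ that is measurable with respect to $\mathcal{F}(t)=\sigma(\Xi(s):0\le s\le t)$, $$\mathbb{E}_\xi[F(\Xi(\cdot))]=\mathrm{E}_{\mathbf u}\Big[F\Big(\sum_{j=1}^N\delta_{V_j(\cdot)}\Big)\det_{1\le j,k\le N}\big[\mathcal{M}^{u_k}_\xi(T,V_j(T))\big]\Big].$$ That is, the noncolliding random walk $(\Xi,\mathbb{P}_\xi)$ has a determinantal martingale representation associated with $(V,\mathcal{M}_\xi)$.
   Context: Random walk (RW): $V(t)$, $t\ge0$, is the continuous-time simple symmetric random walk on $\mathbb{Z}$ with generator $(L_1f)(x)=\frac12[f(x+1)+f(x-1)-2f(x)]$. $\mathbf{V}(t)=(V_1(t),\dots,V_N(t))$ consists of $N$ independent such walks with $\mathbf{V}(0)=\mathbf{u}$ under $\mathrm{P}_{\mathbf u}$ (expectation $\mathrm{E}_{\mathbf u}$). Let $\mathbb{W}_N=\{\mathbf{x}\in\mathbb{R}^N:x_1<\cdots<x_N\}$, $\tau_{\mathbf u}=\inf\{t\ge0:\mathbf{V}(t)\notin\mathbb{W}_N\}$, $h(\mathbf{x})=\prod_{1\le j<k\le N}(x_k-x_j)$. Noncolliding RW: the RW $\mathbf V$ conditioned to stay in $\mathbb{W}_N$ forever, i.e. the Doob $h$-transform of $\mathbf V$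 killed on exiting $\mathbb{W}_N$ ($h$ is harmonic for $\mathbf V$, strictly positive on $\mathbb{W}_N$, zero on its boundary). It is a process $\mathbf{X}(t)\in\mathbb{Z}^N\cap\mathbb{W}_N$ viewed as the unlabeled process $\Xi(t,\cdot)=\sum_{j=1}^N\delta_{X_j(t)}(\cdot)$ in the space of nonnegative integer-valued Radon measures on $\mathbb{Z}$; its law $\mathbb{P}_\xi$ (expectation $\mathbb{E}_\xi$) satisfies, for $0\le t\le T<\infty$ and bounded $\mathcal{F}(t)$-measurable $F$, $$\mathbb{E}_\xi[F(\Xi(\cdot))]=\mathrm{E}_{\mathbf u}\Big[F\Big(\sum_{j=1}^N\delta_{V_j(\cdot)}\Big)\mathbf{1}(\tau_{\mathbf u}>T)\frac{h(\mathbf V(T))}{h(\mathbf u)}\Big].$$ Here $F$ is regarded as a functional of paths of nonnegative integer-valued Radon measures on $\mathbb{Z}$ (multiple points allowed), so it can be evaluated at $\sum_j\delta_{V_j(\cdot)}$. Transformation $\mathcal{S}$ and martingales: $I_\nu(z)=\left(\frac z2\right)^\nu\sum_{\ell=0}^\infty\frac{(z/2)^{2\ell}}{\ell!\,\Gamma(\nu+\ell+1)}$ is the modified Bessel function. For $f:\mathbb{Z}\to\mathbb{C}$, $t\ge0$, $x\in\mathbb{Z}$, $$\mathcal{S}[f(W)\,|\,(t,x)]=e^t\sum_{w\in\mathbb{Z}}I_{|w-x|}(-t)f(w),$$ where $W$ is a dummy variable. For $1\le k\le N$ put $\Phi^{u_k}_\xi(z)=\prod_{1\le j\le N,\,j\ne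 k}\frac{z-u_j}{u_k-u_j}$ and $\mathcal{M}^{u_k}_\xi(t,x)=\mathcal{S}[\Phi^{u_k}_\xi(W)\,|\,(t,x)]$. The displayed identity is what is called the determinantal martingale representation associated with $(V,\mathcal{M}_\xi)$. *)

theory Defs
  imports
    "HOL-Probability.Probability"
    "Jordan_Normal_Form.Determinant"
begin

text \<open>
  Indices run over \<open>{..<N}\<close> instead of \<open>{1..N}\<close>.  A vector of length \<open>N\<close> is a function on
  \<open>nat\<close> of which only the values at \<open>j < N\<close> matter; likewise only the values of a process at
  times \<open>s \<ge> 0\<close> matter.
\<close>

definition L1 :: "(int \<Rightarrow> real) \<Rightarrow> int \<Rightarrow> real" where
  "L1 f x = 1 / 2 * (f (x + 1) + f (x - 1) - 2 * f x)"

text \<open>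
  \<open>L1\<close> is a bounded operator on bounded functions, so the semigroup it generates is
  \<open>exp (t L1)\<close>; the transition probability from \<open>x\<close> to \<open>y\<close> is \<open>(exp (t L1) 1\<^sub>y) x\<close>.
\<close>

definition rw_transition :: "real \<Rightarrow> int \<Rightarrow> int \<Rightarrow> real" where
  "rw_transition t x y = (\<Sum>n. t ^ n / fact n * (L1 ^^ n) (indicator {y}) x)"

definition history :: "'a set \<Rightarrow> 'b measure \<Rightarrow> (real \<Rightarrow> 'a \<Rightarrow> 'b) \<Rightarrow> real \<Rightarrow> 'a measure" where
  "history \<Omega> S Y t = sigma \<Omega> (\<Union>s\<in>{0..t}. {Y s -` A \<inter> \<Omega> | A. A \<in> sets S})"

definition cadlag :: "(real \<Rightarrow> int) \<Rightarrow> bool" where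
  "cadlag p \<longleftrightarrow> (\<forall>t\<ge>0. continuous (at_right t) p) \<and> (\<forall>t>0. \<exists>l. (p \<longlongrightarrow> l) (at_left t))"

definition simple_random_walk :: "'a measure \<Rightarrow> int \<Rightarrow> (real \<Rightarrow> 'a \<Rightarrow> int) \<Rightarrow> bool" where
  "simple_random_walk M x Y \<longleftrightarrow>
     prob_space M \<and>
     (\<forall>t\<ge>0. Y t \<in> M \<rightarrow>\<^sub>M count_space UNIV) \<and>
     (\<forall>\<omega>\<in>space M. cadlag (\<lambda>t. Y t \<omega>)) \<and>
     (AE \<omega> in M. Y 0 \<omega> = x) \<and>
     (\<forall>s\<ge>0. \<forall>t\<ge>s. \<forall>y. AE \<omega> in M.
        real_cond_exp M (history (space M) (count_space UNIV) Y s) (\<lambda>\<omega>. indicator {y} (Y t \<omega>)) \<omega>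
          = rw_transition (t - s) (Y s \<omega>) y)"

text \<open>\<open>V t \<omega> j\<close> is the position of the \<open>j\<close>-th walker; independence is that of whole trajectories.\<close>

definition independent_walks ::
  "nat \<Rightarrow> (nat \<Rightarrow> int) \<Rightarrow> 'a measure \<Rightarrow> (real \<Rightarrow> 'a \<Rightarrow> nat \<Rightarrow> int) \<Rightarrow> bool" where
  "independent_walks N u M V \<longleftrightarrow>
     prob_space M \<and>
     (\<forall>j<N. simple_random_walk M (u j) (\<lambda>t \<omega>. V t \<omega> j)) \<and>
     prob_space.indep_vars M (\<lambda>j. Pi\<^sub>M {0..} (\<lambda>_. count_space UNIV))
       (\<lambda>j \<omega>. \<lambda>t\<in>{0..}. V t \<omega> j) {..<N}"

definition weyl_chamber :: "nat \<Rightarrow> (nat \<Rightarrow> real) set" where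
  "weyl_chamber N = {x. \<forall>j k. j < k \<and> k < N \<longrightarrow> x j < x k}"

definition h_weyl :: "nat \<Rightarrow> (nat \<Rightarrow> real) \<Rightarrow> real" where
  "h_weyl N x = (\<Prod>(j, k)\<in>{(j, k). j < k \<and> k < N}. x k - x j)"

definition rvec :: "(nat \<Rightarrow> int) \<Rightarrow> nat \<Rightarrow> real" where
  "rvec x = (\<lambda>j. real_of_int (x j))"

definition exit_time :: "nat \<Rightarrow> (real \<Rightarrow> 'a \<Rightarrow> nat \<Rightarrow> int) \<Rightarrow> 'a \<Rightarrow> ereal" where
  "exit_time N V \<omega> = Inf (ereal ` {t. 0 \<le> t \<and> rvec (V t \<omega>) \<notin> weyl_chamber N})"

definition labelled_paths :: "nat \<Rightarrow> real \<Rightarrow> (real \<Rightarrow> nat \<Rightarrow> int) measure" where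
  "labelled_paths N T = Pi\<^sub>M {0..T} (\<lambda>_. Pi\<^sub>M {..<N} (\<lambda>_. count_space UNIV))"

definition path_upto ::
  "nat \<Rightarrow> real \<Rightarrow> (real \<Rightarrow> 'a \<Rightarrow> nat \<Rightarrow> int) \<Rightarrow> 'a \<Rightarrow> real \<Rightarrow> nat \<Rightarrow> int" where
  "path_upto N T V \<omega> = (\<lambda>s\<in>{0..T}. \<lambda>j\<in>{..<N}. V s \<omega> j)"

text \<open>
  \<open>X\<close>, on its own probability space \<open>M'\<close>, is the Doob \<open>h\<close>-transform of \<open>V\<close> killed on exiting the
  Weyl chamber: on every time interval \<open>[0, T]\<close> the law of \<open>X\<close> is that of \<open>V\<close> reweighted by
  \<open>1(\<tau> > T) h (V T) / h u\<close>.
\<close>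

definition noncolliding_walk ::
  "nat \<Rightarrow> (nat \<Rightarrow> int) \<Rightarrow> 'a measure \<Rightarrow> (real \<Rightarrow> 'a \<Rightarrow> nat \<Rightarrow> int) \<Rightarrow>
   'b measure \<Rightarrow> (real \<Rightarrow> 'b \<Rightarrow> nat \<Rightarrow> int) \<Rightarrow> bool" where
  "noncolliding_walk N u M V M' X \<longleftrightarrow>
     prob_space M' \<and>
     (\<forall>j<N. \<forall>t\<ge>0. (\<lambda>\<omega>. X t \<omega> j) \<in> M' \<rightarrow>\<^sub>M count_space UNIV) \<and>
     (\<forall>\<omega>\<in>space M'. \<forall>j<N. cadlag (\<lambda>t. X t \<omega> j)) \<and>
     (\<forall>\<omega>\<in>space M'. \<forall>t\<ge>0. rvec (X t \<omega>) \<in> weyl_chamber N) \<and>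
     (\<forall>T\<ge>0. distr M' (labelled_paths N T) (path_upto N T X) =
        distr
          (density M (\<lambda>\<omega>. ennreal
             (of_bool (ereal T < exit_time N V \<omega>) * (h_weyl N (rvec (V T \<omega>)) / h_weyl N (rvec u)))))
          (labelled_paths N T) (path_upto N T V))"

text \<open>
  A nonnegative integer-valued Radon measure \<open>\<xi>\<close> on the integers is represented by the function
  \<open>z \<mapsto> \<xi> {z}\<close>; the sigma-algebra is the one generated by these evaluations, which is the Borel
  sigma-algebra of the vague topology.
\<close>

type_synonym configuration = "int \<Rightarrow> nat"

definition configurations :: "configuration measure" where
  "configurations = Pi\<^sub>M UNIV (\<lambda>_. count_space UNIV)"

definition unlabel :: "nat \<Rightarrow> (nat \<Rightarrow> int) \<Rightarrow> configuration" where
  "unlabel N x = (\<lambda>z. \<Sum>j<N. indicator {x j} z)"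

definition unlabelled_history :: "real \<Rightarrow> (real \<Rightarrow> configuration) measure" where
  "unlabelled_history t = history UNIV configurations (\<lambda>s p. p s) t"

text \<open>
  Only nonnegative integer orders \<open>\<nu> = n\<close> are needed, for which \<open>(z / 2) ^ n\<close> is an integer power
  (no branch cut, and \<open>I\<^sub>0(0) = 1\<close>, which would fail with \<open>powr\<close>).
\<close>

definition bessel_I :: "nat \<Rightarrow> complex \<Rightarrow> complex" where
  "bessel_I n z = (z / 2) ^ n * (\<Sum>l. (z / 2) ^ (2 * l) / (fact l * Gamma (of_nat (n + l + 1))))"

definition S_transform :: "(int \<Rightarrow> complex) \<Rightarrow> real \<Rightarrow> int \<Rightarrow> complex" where
  "S_transform f t x =
     of_real (exp t) * (\<Sum>\<^sub>\<infinity>w\<in>UNIV. bessel_I (nat \<bar>w - x\<bar>) (of_real (- t)) * f w)"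

definition Phi :: "nat \<Rightarrow> (nat \<Rightarrow> int) \<Rightarrow> nat \<Rightarrow> complex \<Rightarrow> complex" where
  "Phi N u k z = (\<Prod>j\<in>{..<N} - {k}. (z - of_int (u j)) / (of_int (u k) - of_int (u j)))"

definition mart :: "nat \<Rightarrow> (nat \<Rightarrow> int) \<Rightarrow> nat \<Rightarrow> real \<Rightarrow> int \<Rightarrow> complex" where
  "mart N u k t x = S_transform (\<lambda>w. Phi N u k (of_int w)) t x"

end

theory Submission
  imports Defs "HOL-Real_Asymp.Real_Asymp"
begin

text \<open>
  Write \<open>h\<close> for the Vandermonde product, \<open>W\<close> for the Weyl chamber and \<open>\<tau>\<close> for the exit time of \<open>V\<close>
  from \<open>W\<close>.  Two facts together give the identity.

  First, the determinant is \<open>h (V T) / h u\<close> (\<open>det_mart_eq_h_ratio\<close>).  The transformation \<open>\<S>\<close> maps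
  \<open>w ^ n\<close> to a monic polynomial of degree \<open>n\<close> in \<open>x\<close>: up to binomial factors, its
  coefficients are moments of the signed
  weights \<open>e\<^sup>t I\<^sub>|\<^sub>k\<^sub>|(-t)\<close>, and the total mass is \<open>1\<close> because \<open>\<Sum>k. I\<^sub>|\<^sub>k\<^sub>|(z) = e\<^sup>z\<close>.  Replacing the monomials
  by a monic family is a unitriangular change of basis, so the determinant does not see it, and what is
  left is the determinant of the interpolation polynomials \<open>\<Phi>\<close> at the points \<open>V\<^sub>j(T)\<close>, a quotient of
  two Vandermonde determinants.

  Secondly, the law of \<open>X\<close> carries the weight \<open>1(\<tau> > T) h (V T) / h u\<close>, so it remains to see that
  the paths with \<open>\<tau> \<le> T\<close> contribute nothing: \<open>E[F(\<Xi>) h(V T) 1(\<tau> \<le> T)] = 0\<close>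
  (\<open>exit_part_cancels_functional\<close>).  This is the reflection principle.  Almost surely the
  walkers move one at a time and by unit steps, so \<open>V\<close> leaves \<open>W\<close> through a collision of two walkers;
  exchanging their labels from then on changes neither the law of \<open>V\<close> nor the unlabelled path, while
  \<open>h (V T)\<close> changes sign.

  The strong Markov property at \<open>\<tau>\<close> is avoided by observing the walks on a finite time grid only.  The
  law of the positions on the grid is an explicit product of transition probabilities
  (\<open>skeleton_distribution\<close>), visibly invariant under exchanging the labels of two walkers after a grid
  time at which they coincide (\<open>skeleton_swap_invariance\<close>).  The price is that within one grid step
  \<open>V\<close> may jump out of \<open>W\<close> without a coincidence at the end of the step.  This needs two elementary
  moves in the step, so it has probability \<open>O(d\<^sup>2)\<close> for a step of length \<open>d\<close>
  (\<open>double_jump_probability\<close>), hence \<open>O(d)\<close> over the whole grid; since \<open>h (V T)\<close> has moments of all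
  orders, its unboundedness costs only a power of \<open>d\<close> (\<open>skeleton_exit_bound\<close>).  Right continuity
  of the paths lets refining grids detect the event \<open>\<tau> \<le> T\<close>, and the error vanishes in the limit
  (\<open>exit_part_cancels\<close>).  This argument treats functionals \<open>F\<close> that are products over finitely many
  times; these determine a finite measure on paths, which gives the general case.
\<close>

section \<open>Determinants of polynomial families\<close>

definition vandermonde_mat :: "nat \<Rightarrow> (nat \<Rightarrow> 'a::comm_ring_1) \<Rightarrow> 'a mat" where
  "vandermonde_mat n x = mat n n (\<lambda>(j, i). x j ^ i)"

lemma poly_eq_sum_lessThan:
  fixes p :: "'a::comm_semiring_1 poly"
  assumes "degree p < n"
  shows "poly p z = (\<Sum>l<n. coeff p l * z ^ l)"
proof -
  have "poly p z = (\<Sum>l\<le>degree p. coeff p l * z ^ l)"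
    by (rule poly_altdef)
  also have "\<dots> = (\<Sum>l<n. coeff p l * z ^ l)"
    using assms by (intro sum.mono_neutral_left) (auto simp: coeff_eq_0)
  finally show ?thesis .
qed

text \<open>
  Evaluating a polynomial is pairing its coefficients with the powers of the point, so the matrix of values
  factors through the Vandermonde matrix.
\<close>

lemma det_eval_mat:
  fixes p :: "nat \<Rightarrow> 'a::comm_ring_1 poly"
  assumes "\<And>k. k < n \<Longrightarrow> degree (p k) < n"
  shows "Determinant.det (mat n n (\<lambda>(j, k). poly (p k) (x j))) =
    Determinant.det (vandermonde_mat n x) * Determinant.det (mat n n (\<lambda>(l, k). coeff (p k) l))"
proof -
  have "mat n n (\<lambda>(j, k). poly (p k) (x j)) =
      vandermonde_mat n x * mat n n (\<lambda>(l, k). coeff (p k) l)"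
    by (rule eq_matI)
       (auto simp: vandermonde_mat_def scalar_prod_def poly_eq_sum_lessThan[OF assms]
          atLeast0LessThan mult.commute intro!: sum.cong)
  then show ?thesis
    by (simp add: det_mult[of _ n] vandermonde_mat_def)
qed

text \<open>
  Here the coefficient matrix is unitriangular: the determinant of values does not depend on which monic
  family is used.
\<close>

lemma det_eval_mat_monic:
  fixes p :: "nat \<Rightarrow> 'a::comm_ring_1 poly"
  assumes deg: "\<And>k. k < n \<Longrightarrow> degree (p k) \<le> k"
    and lead: "\<And>k. k < n \<Longrightarrow> coeff (p k) k = 1"
  shows "Determinant.det (mat n n (\<lambda>(j, k). poly (p k) (x j))) = Determinant.det (vandermonde_mat n x)"
proof -
  let ?C = "mat n n (\<lambda>(l, k). coeff (p k) l)"
  have "upper_triangular ?C"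
    using deg by (auto simp: coeff_eq_0 intro!: upper_triangularI) (meson coeff_eq_0 le_less_trans less_trans)
  then have "Determinant.det ?C = prod_list (diag_mat ?C)"
    by (intro det_upper_triangular[of _ n]) auto
  also have "\<dots> = 1"
    by (simp add: prod_list_diag_prod lead)
  finally show ?thesis
    using det_eval_mat[of n p x] deg by (metis le_less_trans mult_1_right)
qed

text \<open>
  By \<open>det_eval_mat_monic\<close> the monomials may be replaced by the Newton polynomials
  \<open>\<Prod>l<k. (z - x l)\<close>, for which the matrix of values is triangular.
\<close>

lemma det_vandermonde:
  fixes x :: "nat \<Rightarrow> 'a::idom"
  shows "Determinant.det (vandermonde_mat n x) = (\<Prod>(j, k)\<in>{(j, k). j < k \<and> k < n}. x k - x j)"
proof -
  define q where "q i = (\<Prod>l<i. [:- x l, 1:])" for i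
  let ?Q = "mat n n (\<lambda>(j, k). poly (q k) (x j))"
  have deg: "degree (q i) = i" and lead: "coeff (q i) i = 1" for i
  proof -
    show d: "degree (q i) = i"
      unfolding q_def by (subst degree_prod_eq_sum_degree) auto
    have "lead_coeff (q i) = 1"
      unfolding q_def by (simp add: lead_coeff_prod)
    then show "coeff (q i) i = 1"
      by (simp add: d)
  qed
  have "Determinant.det (vandermonde_mat n x) = Determinant.det ?Q"
    by (rule det_eval_mat_monic[symmetric]) (auto simp: deg lead)
  also have "\<dots> = prod_list (diag_mat ?Q)"
    by (intro det_lower_triangular[of n]) (auto simp: q_def poly_prod)
  also have "\<dots> = (\<Prod>k<n. \<Prod>j<k. x k - x j)"
    by (simp add: prod_list_diag_prod atLeast0LessThan q_def poly_prod)
  also have "\<dots> = (\<Prod>(k, j)\<in>(SIGMA k:{..<n}. {..<k}). x k - x j)"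
    by (rule prod.Sigma) auto
  also have "\<dots> = (\<Prod>(j, k)\<in>{(j, k). j < k \<and> k < n}. x k - x j)"
    by (rule prod.reindex_bij_witness[of _ "\<lambda>(j, k). (k, j)" "\<lambda>(j, k). (k, j)"]) auto
  finally show ?thesis .
qed

lemma det_vandermonde_rvec:
  "Determinant.det (vandermonde_mat N (\<lambda>j. of_int (x j) :: complex)) = of_real (h_weyl N (rvec x))"
  unfolding det_vandermonde h_weyl_def rvec_def of_real_prod by (intro prod.cong) auto

definition Phi_poly :: "nat \<Rightarrow> (nat \<Rightarrow> int) \<Rightarrow> nat \<Rightarrow> complex poly" where
  "Phi_poly N u k =
     (\<Prod>j\<in>{..<N} - {k}. [:- of_int (u j) / (of_int (u k) - of_int (u j)), 1 / (of_int (u k) - of_int (u j)):])"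

lemma poly_Phi_poly: "poly (Phi_poly N u k) z = Phi N u k z"
  unfolding Phi_poly_def Phi_def poly_prod
  by (intro prod.cong) (auto simp: diff_divide_distrib)

lemma degree_Phi_poly: "k < N \<Longrightarrow> degree (Phi_poly N u k) < N"
proof -
  assume "k < N"
  have "degree (Phi_poly N u k) \<le> sum (degree \<circ> (\<lambda>j. [:- of_int (u j) / (of_int (u k) - of_int (u j)), 1 / (of_int (u k) - of_int (u j)) :: complex:])) ({..<N} - {k})"
    unfolding Phi_poly_def by (rule degree_prod_sum_le) auto
  also have "\<dots> \<le> (\<Sum>j\<in>{..<N} - {k}. 1)"
    by (intro sum_mono) auto
  also have "\<dots> < N"
    using \<open>k < N\<close> by simp
  finally show ?thesis .
qed

lemma Phi_at_nodes:
  assumes "strict_mono_on {..<N} u" "j < N" "k < N"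
  shows "Phi N u k (of_int (u j)) = (if j = k then 1 else 0)"
proof -
  have "u k \<noteq> u i" if "i < N" "i \<noteq> k" for i
    using strict_mono_on_eqD[OF assms(1), of k i] that assms by auto
  then show ?thesis
    using assms by (auto simp: Phi_def intro!: prod.neutral)
qed

text \<open>
  The interpolation polynomials have the identity as matrix of values at the nodes \<open>u\<close>; factoring it
  through the Vandermonde matrix of \<open>u\<close> identifies the determinant of their coefficients as \<open>1 / h u\<close>.
\<close>

lemma det_Phi_coeffs:
  assumes "strict_mono_on {..<N} u"
  shows "of_real (h_weyl N (rvec u)) * Determinant.det (mat N N (\<lambda>(l, k). coeff (Phi_poly N u k) l)) = 1"
proof -
  have "mat N N (\<lambda>(j, k). poly (Phi_poly N u k) (of_int (u j))) = 1\<^sub>m N"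
    by (rule eq_matI) (auto simp: poly_Phi_poly Phi_at_nodes[OF assms])
  then show ?thesis
    using det_eval_mat[of N "Phi_poly N u" "\<lambda>j. of_int (u j)"]
    by (simp add: degree_Phi_poly det_vandermonde_rvec)
qed

section \<open>The transformation \<open>\<S>\<close> on polynomials\<close>

lemma power_le_fact_exp:
  fixes x :: real
  assumes "0 \<le> x"
  shows "x ^ n \<le> fact n * exp x"
proof -
  have "(\<Sum>i\<in>{n}. x ^ i /\<^sub>R fact i) \<le> (\<Sum>i. x ^ i /\<^sub>R fact i)"
    by (rule sum_le_suminf) (use assms exp_converges[of x] in \<open>auto simp: sums_iff\<close>)
  then show ?thesis
    by (simp add: exp_def field_simps)
qed

text \<open>
  The double series of \<open>exp (z / 2) * exp (z / 2)\<close> with weight \<open>f\<close> on the difference \<open>a - b\<close> of the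
  indices.  Grouping its terms by \<open>k = a - b\<close> produces the Bessel functions \<open>I\<^sub>|\<^sub>k\<^sub>|(z)\<close>, which is the
  generating function of the Bessel functions read off at \<open>1\<close>.
\<close>

definition exp_pair_term :: "complex \<Rightarrow> (int \<Rightarrow> complex) \<Rightarrow> nat \<times> nat \<Rightarrow> complex" where
  "exp_pair_term z f = (\<lambda>(a, b). (z / 2) ^ a / fact a * ((z / 2) ^ b / fact b) * f (int a - int b))"

lemma has_sum_exp_complex: "((\<lambda>a. z ^ a / fact a) has_sum exp z) (UNIV :: nat set)" for z :: complex
  using norm_summable_imp_has_sum[OF summable_norm_exp exp_converges[of z]]
  by (simp add: scaleR_conv_of_real divide_inverse mult.commute)

lemma has_sum_exp_real: "((\<lambda>a. x ^ a / fact a) has_sum exp x) (UNIV :: nat set)" for x :: real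
  using norm_summable_imp_has_sum[OF summable_norm_exp exp_converges[of x]]
  by (simp add: divide_inverse mult.commute)

text \<open>
  Since \<open>exp \<bar>a - b\<bar> \<le> exp a * exp b\<close>, such a weight only rescales the arguments of the two
  exponential series.
\<close>

lemma exp_pair_term_abs_summable:
  assumes "\<And>k. norm (f k) \<le> C * exp \<bar>of_int k\<bar>"
  shows "(\<lambda>p. norm (exp_pair_term z f p)) summable_on UNIV"
proof (rule Infinite_Sum.abs_summable_on_comparison_test')
  define r where "r = exp 1 * norm (z / 2)"
  have r: "0 \<le> r"
    by (simp add: r_def)
  have "(\<lambda>(a, b). (r ^ a / fact a) * (r ^ b / fact b)) summable_on (UNIV \<times> UNIV :: (nat \<times> nat) set)"
  proof (rule summable_on_SigmaI)
    show "((\<lambda>b. case (a, b) of (a, b) \<Rightarrow> (r ^ a / fact a) * (r ^ b / fact b)) has_sum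
        (r ^ a / fact a * exp r)) UNIV" for a
      using has_sum_cmult_right[OF has_sum_exp_real[of r], of "r ^ a / fact a"] by simp
    show "(\<lambda>a. r ^ a / fact a * exp r) summable_on UNIV"
      by (intro summable_on_cmult_left has_sum_imp_summable[OF has_sum_exp_real])
  qed (use r in auto)
  then show "(\<lambda>p. C * (case p of (a, b) \<Rightarrow> (r ^ a / fact a) * (r ^ b / fact b))) summable_on UNIV"
    by (intro summable_on_cmult_right) simp
  fix p :: "nat \<times> nat"
  obtain a b where p: "p = (a, b)" by force
  have C: "0 \<le> C"
    using order_trans[OF norm_ge_zero assms[of 0]] by (simp add: zero_le_mult_iff)
  have "norm (f (int a - int b)) \<le> C * exp (real a + real b)"
    by (rule order_trans[OF assms]) (auto intro!: mult_left_mono C)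
  also have "exp (real a + real b) = exp 1 ^ a * exp 1 ^ b"
    by (simp add: exp_add exp_of_nat_mult[symmetric])
  finally have "norm (z / 2) ^ a / fact a * (norm (z / 2) ^ b / fact b) * norm (f (int a - int b)) \<le>
      norm (z / 2) ^ a / fact a * (norm (z / 2) ^ b / fact b) * (C * (exp 1 ^ a * exp 1 ^ b))"
    by (intro mult_left_mono) auto
  also have "norm (z / 2) ^ a / fact a * (norm (z / 2) ^ b / fact b) * norm (f (int a - int b)) =
      norm (exp_pair_term z f p)"
    by (simp add: p exp_pair_term_def norm_mult norm_divide norm_power)
  finally have "norm (exp_pair_term z f p) \<le>
      norm (z / 2) ^ a / fact a * (norm (z / 2) ^ b / fact b) * (C * (exp 1 ^ a * exp 1 ^ b))" .
  also have "\<dots> = C * (case p of (a, b) \<Rightarrow> (r ^ a / fact a) * (r ^ b / fact b))"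
  proof -
    have "r ^ n = exp 1 ^ n * norm (z / 2) ^ n" for n
      by (simp only: r_def power_mult_distrib)
    then show ?thesis
      by (simp add: p mult_ac)
  qed
  finally show "norm (exp_pair_term z f p) \<le> \<dots>" .
qed

text \<open>
  The pairs \<open>(a, b)\<close> with \<open>a - b = k\<close> are \<open>(l + k\<^sup>+, l + k\<^sup>-)\<close>; the corresponding terms are those of the
  Bessel series of order \<open>\<bar>k\<bar>\<close>.
\<close>

lemma bessel_I_sums:
  "((\<lambda>l. (z / 2) ^ (l + nat k) / fact (l + nat k) * ((z / 2) ^ (l + nat (- k)) / fact (l + nat (- k))))
    has_sum bessel_I (nat \<bar>k\<bar>) z) UNIV"
  (is "(?g has_sum _) _")
proof -
  let ?n = "nat \<bar>k\<bar>"
  have eq: "?g = (\<lambda>l. (z / 2) ^ ?n * ((z / 2) ^ (2 * l) / (fact l * Gamma (of_nat (?n + l + 1)))))"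
  proof
    fix l
    have G: "Gamma (of_nat (?n + l + 1) :: complex) = fact (?n + l)"
      using Gamma_fact[of "?n + l", where 'a = complex] by (simp add: add_ac)
    show "?g l = (z / 2) ^ ?n * ((z / 2) ^ (2 * l) / (fact l * Gamma (of_nat (?n + l + 1))))"
      unfolding G by (cases "0 \<le> k") (simp_all add: power_add mult_2 mult_2_right mult_ac add_ac)
  qed
  have abs: "(\<lambda>p. norm (exp_pair_term z (\<lambda>_. 1) p)) summable_on UNIV"
    by (rule exp_pair_term_abs_summable[where C = 1]) simp
  have "(\<lambda>p. norm (exp_pair_term z (\<lambda>_. 1) p)) summable_on range (\<lambda>l. (l + nat k, l + nat (- k)))"
    by (rule summable_on_subset_banach[OF abs]) simp
  then have s: "(\<lambda>l. norm (?g l)) summable_on UNIV"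
    by (subst (asm) summable_on_reindex) (auto simp: inj_on_def exp_pair_term_def o_def)
  then have sums: "?g sums (\<Sum>\<^sub>\<infinity>l. ?g l)"
    by (intro has_sum_imp_sums has_sum_infsum) (rule Infinite_Sum.abs_summable_summable)
  have bessel: "?g sums bessel_I ?n z"
    unfolding eq bessel_I_def
  proof -
    have "summable (\<lambda>l. (z / 2) ^ (2 * l) / (fact l * Gamma (of_nat (?n + l + 1))))"
    proof (cases "z = 0")
      case True
      show ?thesis
        by (rule summable_finite[of "{0}"]) (use True in auto)
    next
      case False
      show ?thesis
        by (rule summable_mult_D[OF sums_summable[OF sums, unfolded eq]]) (use False in simp)
    qed
    then show "(\<lambda>l. (z / 2) ^ ?n * ((z / 2) ^ (2 * l) / (fact l * Gamma (of_nat (?n + l + 1))))) sums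
      ((z / 2) ^ ?n * (\<Sum>l. (z / 2) ^ (2 * l) / (fact l * Gamma (of_nat (?n + l + 1)))))"
      by (intro sums_mult summable_sums)
  qed
  have hs: "(?g has_sum (\<Sum>\<^sub>\<infinity>l. ?g l)) UNIV"
    by (rule has_sum_infsum[OF Infinite_Sum.abs_summable_summable[OF s]])
  show ?thesis
    using hs unfolding sums_unique2[OF has_sum_imp_sums[OF hs] bessel] .
qed

lemma bessel_sum_eq_pair_sum:
  assumes "\<And>k. norm (f k) \<le> C * exp \<bar>of_int k\<bar>"
  shows "((\<lambda>k. bessel_I (nat \<bar>k\<bar>) z * f k) has_sum infsum (exp_pair_term z f) UNIV) UNIV"
proof -
  let ?h = "\<lambda>(k, l). exp_pair_term z f (l + nat k, l + nat (- k))"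
  have sum: "(exp_pair_term z f has_sum infsum (exp_pair_term z f) UNIV) UNIV"
    by (rule has_sum_infsum[OF Infinite_Sum.abs_summable_summable[OF exp_pair_term_abs_summable[OF assms]]])
  have "(?h has_sum infsum (exp_pair_term z f) UNIV) (SIGMA k:UNIV. UNIV)"
    using sum
    by (subst has_sum_reindex_bij_witness[where j = "\<lambda>(k, l). (l + nat k, l + nat (- k))" and
          i = "\<lambda>(a, b). (int a - int b, min a b)" and T = UNIV and h = "exp_pair_term z f"])
       (auto simp: min_def split: if_splits)
  moreover have "((\<lambda>l. ?h (k, l)) has_sum (bessel_I (nat \<bar>k\<bar>) z * f k)) UNIV" for k
    using has_sum_cmult_left[OF bessel_I_sums[of z k], of "f k"]
    by (auto simp: exp_pair_term_def cong: has_sum_cong)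
  ultimately show ?thesis
    by (intro has_sum_SigmaD[of ?h]) auto
qed

lemma bessel_generating_function_at_1:
  "((\<lambda>k. bessel_I (nat \<bar>k\<bar>) z) has_sum exp z) UNIV"
proof -
  have abs: "(\<lambda>p. norm (exp_pair_term z (\<lambda>_. 1) p)) summable_on UNIV"
    by (rule exp_pair_term_abs_summable[where C = 1]) simp
  have "infsum (exp_pair_term z (\<lambda>_. 1)) (UNIV \<times> UNIV) =
      (\<Sum>\<^sub>\<infinity>a. \<Sum>\<^sub>\<infinity>b. (z / 2) ^ a / fact a * ((z / 2) ^ b / fact b))"
    using Infinite_Sum.abs_summable_summable[OF abs]
    by (subst infsum_Sigma_banach[symmetric]) (auto simp: exp_pair_term_def)
  also have "\<dots> = (\<Sum>\<^sub>\<infinity>a. (z / 2) ^ a / fact a) * (\<Sum>\<^sub>\<infinity>b. (z / 2) ^ b / fact b)"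
    by (simp only: infsum_cmult_left' infsum_cmult_right')
  also have "\<dots> = exp z"
    by (simp add: infsumI[OF has_sum_exp_complex] exp_add[symmetric])
  finally show ?thesis
    using bessel_sum_eq_pair_sum[of "\<lambda>_. 1" 1 z] by simp
qed

lemma bessel_times_power_summable:
  "(\<lambda>w. bessel_I (nat \<bar>w - x\<bar>) z * of_int w ^ l) summable_on UNIV"
proof -
  have "norm (of_int (k + x) ^ l :: complex) \<le> fact l * exp \<bar>of_int x\<bar> * exp \<bar>of_int k\<bar>" for k
  proof -
    have "norm (of_int (k + x) ^ l :: complex) \<le> (\<bar>real_of_int x\<bar> + \<bar>real_of_int k\<bar>) ^ l"
      unfolding norm_power norm_of_int by (intro power_mono) auto
    also have "\<dots> \<le> fact l * exp (\<bar>real_of_int x\<bar> + \<bar>real_of_int k\<bar>)"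
      by (rule power_le_fact_exp) auto
    finally show ?thesis
      by (simp add: exp_add mult_ac)
  qed
  from bessel_sum_eq_pair_sum[OF this]
  have "(\<lambda>k. bessel_I (nat \<bar>k\<bar>) z * of_int (k + x) ^ l) summable_on UNIV"
    by (auto simp: summable_on_def)
  then show ?thesis
    by (subst summable_on_reindex_bij_witness[where j = "\<lambda>w. w - x" and i = "\<lambda>k. k + x" and T = UNIV and
          h = "\<lambda>k. bessel_I (nat \<bar>k\<bar>) z * of_int (k + x) ^ l"]) auto
qed

lemma infsum_finite_sum:
  fixes f :: "'i \<Rightarrow> 'b \<Rightarrow> 'c::{topological_comm_monoid_add, t2_space}"
  assumes "\<And>i. i \<in> I \<Longrightarrow> f i summable_on A"
  shows "(\<Sum>\<^sub>\<infinity>a\<in>A. \<Sum>i\<in>I. f i a) = (\<Sum>i\<in>I. \<Sum>\<^sub>\<infinity>a\<in>A. f i a)"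
proof -
  have "((\<lambda>a. \<Sum>i\<in>I. f i a) has_sum (\<Sum>i\<in>I. \<Sum>\<^sub>\<infinity>a\<in>A. f i a)) A"
    using assms
    by (induction I rule: infinite_finite_induct) (auto intro!: has_sum_add has_sum_infsum)
  then show ?thesis
    by (rule infsumI)
qed

text \<open>
  The moments of the signed weights \<open>e\<^sup>t I\<^sub>|\<^sub>k\<^sub>|(-t)\<close> on the integers that define \<open>\<S>\<close>.
\<close>

definition S_moment :: "real \<Rightarrow> nat \<Rightarrow> complex" where
  "S_moment t i = of_real (exp t) * (\<Sum>\<^sub>\<infinity>k\<in>UNIV. bessel_I (nat \<bar>k\<bar>) (of_real (- t)) * of_int k ^ i)"

text \<open>
  The image of \<open>w ^ n\<close> under \<open>\<S>\<close>, obtained by expanding \<open>(x + k) ^ n\<close> binomially and summing over \<open>k\<close>.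
\<close>

definition S_power :: "real \<Rightarrow> nat \<Rightarrow> complex poly" where
  "S_power t n = (\<Sum>i\<le>n. monom (of_nat (n choose i) * S_moment t i) (n - i))"

lemma S_moment_0: "S_moment t 0 = 1"
  using infsumI[OF bessel_generating_function_at_1[of "of_real (- t)"]]
  by (simp add: S_moment_def exp_of_real exp_minus)

lemma degree_S_power: "degree (S_power t n) \<le> n"
  unfolding S_power_def by (intro degree_sum_le) (auto intro: order_trans[OF degree_monom_le])

text \<open>
  The leading coefficient is the total mass of the weights, which is \<open>e\<^sup>t * e\<^sup>-\<^sup>t = 1\<close>.
\<close>

lemma coeff_S_power: "coeff (S_power t n) n = 1"
proof -
  have "coeff (S_power t n) n = (\<Sum>i\<le>n. if i = 0 then of_nat (n choose i) * S_moment t i else 0)"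
    unfolding S_power_def coeff_sum by (intro sum.cong) auto
  then show ?thesis
    by (simp add: S_moment_0)
qed

lemma S_transform_power: "S_transform (\<lambda>w. of_int w ^ n) t x = poly (S_power t n) (of_int x)"
proof -
  let ?I = "\<lambda>k. bessel_I (nat \<bar>k\<bar>) (of_real (- t))"
  have "(\<Sum>\<^sub>\<infinity>w. bessel_I (nat \<bar>w - x\<bar>) (of_real (- t)) * of_int w ^ n) = (\<Sum>\<^sub>\<infinity>k. ?I k * of_int (k + x) ^ n)"
    by (rule infsum_reindex_bij_witness[where j = "\<lambda>w. w - x" and i = "\<lambda>k. k + x"]) auto
  also have "\<dots> = (\<Sum>\<^sub>\<infinity>k. \<Sum>i\<le>n. of_nat (n choose i) * of_int x ^ (n - i) * (?I k * of_int k ^ i))"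
    by (intro infsum_cong) (auto simp: binomial_ring sum_distrib_left mult_ac intro!: sum.cong)
  also have "\<dots> = (\<Sum>i\<le>n. \<Sum>\<^sub>\<infinity>k. of_nat (n choose i) * of_int x ^ (n - i) * (?I k * of_int k ^ i))"
    by (intro infsum_finite_sum summable_on_cmult_right)
       (use bessel_times_power_summable[of 0] in auto)
  also have "\<dots> = (\<Sum>i\<le>n. of_nat (n choose i) * of_int x ^ (n - i) * (\<Sum>\<^sub>\<infinity>k. ?I k * of_int k ^ i))"
    by (simp only: infsum_cmult_right')
  finally show ?thesis
    by (simp add: S_transform_def S_power_def poly_sum poly_monom S_moment_def sum_distrib_left mult_ac)
qed

lemma S_transform_poly:
  assumes "degree p < n"
  shows "S_transform (\<lambda>w. poly p (of_int w)) t x = (\<Sum>l<n. coeff p l * poly (S_power t l) (of_int x))"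
proof -
  have "(\<Sum>\<^sub>\<infinity>w. bessel_I (nat \<bar>w - x\<bar>) (of_real (- t)) * poly p (of_int w)) =
      (\<Sum>\<^sub>\<infinity>w. \<Sum>l<n. coeff p l * (bessel_I (nat \<bar>w - x\<bar>) (of_real (- t)) * of_int w ^ l))"
    by (simp add: poly_eq_sum_lessThan[OF assms] sum_distrib_left mult_ac)
  also have "\<dots> = (\<Sum>l<n. \<Sum>\<^sub>\<infinity>w. coeff p l * (bessel_I (nat \<bar>w - x\<bar>) (of_real (- t)) * of_int w ^ l))"
    by (intro infsum_finite_sum summable_on_cmult_right bessel_times_power_summable)
  also have "\<dots> = (\<Sum>l<n. coeff p l * (\<Sum>\<^sub>\<infinity>w. bessel_I (nat \<bar>w - x\<bar>) (of_real (- t)) * of_int w ^ l))"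
    by (simp only: infsum_cmult_right')
  finally show ?thesis
    by (simp add: S_transform_power[symmetric] S_transform_def sum_distrib_left mult_ac)
qed

text \<open>
  By linearity the matrix is the matrix of values of the monic family \<open>S_power\<close> times the coefficient
  matrix of the interpolation polynomials; the first factor has determinant \<open>h x\<close>, the second \<open>1 / h u\<close>.
\<close>

proposition det_mart_eq_h_ratio:
  assumes "strict_mono_on {..<N} u"
  shows "Determinant.det (mat N N (\<lambda>(j, k). mart N u k t (x j))) =
    of_real (h_weyl N (rvec x) / h_weyl N (rvec u))"
proof -
  let ?S = "mat N N (\<lambda>(j, l). poly (S_power t l) (of_int (x j)))"
  let ?C = "mat N N (\<lambda>(l, k). coeff (Phi_poly N u k) l)"
  have "mat N N (\<lambda>(j, k). mart N u k t (x j)) = ?S * ?C"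
  proof (rule eq_matI)
    fix j k assume "j < dim_row (?S * ?C)" "k < dim_col (?S * ?C)"
    then show "mat N N (\<lambda>(j, k). mart N u k t (x j)) $$ (j, k) = (?S * ?C) $$ (j, k)"
      using S_transform_poly[OF degree_Phi_poly[of k N u], of t "x j"]
      by (auto simp: mart_def poly_Phi_poly scalar_prod_def atLeast0LessThan mult.commute intro!: sum.cong)
  qed auto
  then have "Determinant.det (mat N N (\<lambda>(j, k). mart N u k t (x j))) =
      Determinant.det ?S * Determinant.det ?C"
    by (simp add: det_mult[of _ N])
  also have "Determinant.det ?S = of_real (h_weyl N (rvec x))"
    using det_eval_mat_monic[of N "S_power t" "\<lambda>j. of_int (x j)"]
    by (simp add: degree_S_power coeff_S_power det_vandermonde_rvec)
  also have "of_real (h_weyl N (rvec x)) * Determinant.det ?C = of_real (h_weyl N (rvec x) / h_weyl N (rvec u))"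
  proof -
    have 1: "of_real (h_weyl N (rvec u)) * Determinant.det ?C = 1"
      by (rule det_Phi_coeffs[OF assms])
    then have "Determinant.det ?C = 1 / of_real (h_weyl N (rvec u))"
      by (subst eq_divide_eq) (auto simp: mult.commute)
    then show ?thesis
      by simp
  qed
  finally show ?thesis .
qed

section \<open>Transition probabilities of the simple random walk\<close>

lemma L1_power_bound:
  assumes "\<And>x. \<bar>f x\<bar> \<le> B"
  shows "\<bar>(L1 ^^ n) f x\<bar> \<le> 2 ^ n * B"
proof (induction n arbitrary: x)
  case 0
  then show ?case using assms by simp
next
  case (Suc n)
  show ?case
    using Suc.IH[of x] Suc.IH[of "x + 1"] Suc.IH[of "x - 1"] by (simp add: L1_def[of "(L1 ^^ n) f"])
qed

lemma L1_power_indicator_far: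
  assumes "n < nat \<bar>x - y\<bar>"
  shows "(L1 ^^ n) (indicator {y}) x = 0"
  using assms
proof (induction n arbitrary: x)
  case 0
  then show ?case by auto
next
  case (Suc n)
  have "(L1 ^^ n) (indicator {y}) x' = 0" if "x' \<in> {x - 1, x, x + 1}" for x'
    using Suc.prems that by (intro Suc.IH) auto
  then show ?case
    by (simp add: L1_def[of "(L1 ^^ n) (indicator {y})"])
qed

lemma L1_power_indicator_shift:
  "(L1 ^^ n) (indicator {y + c}) (x + c) = (L1 ^^ n) (indicator {y}) x"
proof (induction n arbitrary: x)
  case 0
  then show ?case by (simp add: indicator_def)
next
  case (Suc n)
  show ?case
    using Suc.IH[of x] Suc.IH[of "x + 1"] Suc.IH[of "x - 1"]
    by (simp add: L1_def[of "(L1 ^^ n) (indicator _)"] algebra_simps)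
qed

lemma rw_transition_shift: "rw_transition t (x + c) (y + c) = rw_transition t x y"
  unfolding rw_transition_def L1_power_indicator_shift ..

lemma L1_power_indicator_bound: "\<bar>(L1 ^^ n) (indicator {y}) x\<bar> \<le> 2 ^ n"
  using L1_power_bound[of "indicator {y}" 1 n x] by (simp add: indicator_def)

lemma exp_series_sums: "(\<lambda>n. x ^ n / fact n) sums exp x" for x :: real
  by (rule has_sum_imp_sums[OF has_sum_exp_real])

lemma rw_transition_term_bound:
  assumes "0 \<le> t"
  shows "\<bar>t ^ n / fact n * (L1 ^^ n) (indicator {y}) x\<bar> \<le> (2 * t) ^ n / fact n"
proof -
  have "\<bar>t ^ n / fact n * (L1 ^^ n) (indicator {y}) x\<bar> \<le> t ^ n / fact n * 2 ^ n"
    unfolding abs_mult using assms L1_power_indicator_bound by (intro mult_mono) auto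
  then show ?thesis
    by (simp add: power_mult_distrib mult_ac)
qed

lemma rw_transition_sums:
  assumes "0 \<le> t"
  shows "(\<lambda>n. t ^ n / fact n * (L1 ^^ n) (indicator {y}) x) sums rw_transition t x y"
  unfolding rw_transition_def
proof (rule summable_sums, rule summable_comparison_test'[where N = 0])
  show "summable (\<lambda>n. (2 * t) ^ n / fact n)"
    by (rule sums_summable[OF exp_series_sums])
qed (use rw_transition_term_bound[OF assms] in auto)

text \<open>
  A walk needs at least \<open>\<bar>x - y\<bar>\<close> steps to get from \<open>x\<close> to \<open>y\<close>, so only the terms with
  \<open>n \<ge> \<bar>x - y\<bar>\<close> of the exponential series survive, and on these
  \<open>1 \<le> exp 2 ^ n * exp (- 2 * \<bar>x - y\<bar>)\<close>.  The rate \<open>2\<close> leaves room for summing against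
  \<open>exp \<bar>x - y\<bar>\<close> in the moment estimate.
\<close>

lemma rw_transition_exp_bound:
  assumes "0 \<le> t"
  shows "rw_transition t x y \<le> exp (2 * exp 2 * t) * exp (- 2 * \<bar>of_int (x - y)\<bar>)"
proof -
  let ?d = "nat \<bar>x - y\<bar>"
  have "t ^ n / fact n * (L1 ^^ n) (indicator {y}) x \<le> (2 * exp 2 * t) ^ n / fact n * exp (- 2 * real ?d)" for n
  proof (cases "n < ?d")
    case True
    then show ?thesis
      using assms by (simp add: L1_power_indicator_far)
  next
    case False
    have "t ^ n / fact n * (L1 ^^ n) (indicator {y}) x \<le> (2 * t) ^ n / fact n * 1"
      using order_trans[OF abs_ge_self rw_transition_term_bound[OF assms, of n y x]] by simp
    also have "\<dots> \<le> (2 * t) ^ n / fact n * (exp 2 ^ n * exp (- 2 * real ?d))"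
      using assms False
      by (intro mult_left_mono) (auto simp: exp_of_nat_mult[symmetric] exp_add[symmetric])
    also have "\<dots> = (2 * exp 2 * t) ^ n / fact n * exp (- 2 * real ?d)"
      by (simp add: power_mult_distrib)
    finally show ?thesis .
  qed
  from sums_le[OF this rw_transition_sums[OF assms] sums_mult2[OF exp_series_sums]] show ?thesis
    by simp
qed

text \<open>
  The exponential series up to first order: within a short time \<open>t\<close> the walk stays or makes one step,
  up to an error of order \<open>t\<^sup>2\<close> that is uniform in space.
\<close>

lemma rw_transition_short_time:
  assumes "0 \<le> t"
  shows "\<bar>rw_transition t x y - (indicator {y} x + t * L1 (indicator {y}) x)\<bar> \<le> (2 * t)\<^sup>2 * exp (2 * t)"
proof -
  let ?a = "\<lambda>n. t ^ n / fact n * (L1 ^^ n) (indicator {y}) x"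
  have "(\<lambda>n. ?a (n + 2)) sums (rw_transition t x y - (\<Sum>n<2. ?a n))"
    by (rule sums_split_initial_segment[OF rw_transition_sums[OF assms]])
  moreover have "(\<Sum>n<2. ?a n) = indicator {y} x + t * L1 (indicator {y}) x"
    by (simp add: numeral_2_eq_2)
  ultimately have s: "(\<lambda>n. ?a (n + 2)) sums (rw_transition t x y - (indicator {y} x + t * L1 (indicator {y}) x))"
    by simp
  have "\<bar>?a (n + 2)\<bar> \<le> (2 * t)\<^sup>2 * ((2 * t) ^ n / fact n)" for n
  proof -
    have "\<bar>?a (n + 2)\<bar> \<le> (2 * t) ^ (n + 2) / fact (n + 2)"
      by (rule rw_transition_term_bound[OF assms])
    also have "\<dots> \<le> (2 * t) ^ (n + 2) / fact n"
      using assms by (intro divide_left_mono fact_mono) auto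
    finally show ?thesis
      by (simp add: power_add power2_eq_square mult_ac)
  qed
  then have bnd: "?a (n + 2) \<le> (2 * t)\<^sup>2 * ((2 * t) ^ n / fact n)"
    "- ((2 * t)\<^sup>2 * ((2 * t) ^ n / fact n)) \<le> ?a (n + 2)" for n
    unfolding abs_le_iff minus_le_iff[of "(2 * t)\<^sup>2 * ((2 * t) ^ n / fact n)"] by blast+
  have e: "(\<lambda>n. (2 * t)\<^sup>2 * ((2 * t) ^ n / fact n)) sums ((2 * t)\<^sup>2 * exp (2 * t))"
    by (intro sums_mult exp_series_sums)
  show ?thesis
    using sums_le[OF bnd(1) s e] sums_le[OF bnd(2) sums_minus[OF e] s] by (simp add: abs_le_iff)
qed

section \<open>Marginals, increments and moments of one walk\<close>

lemma space_history [simp]: "space (history \<Omega> S Y t) = \<Omega>"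
  by (auto simp: history_def space_measure_of_conv)

lemma sets_history:
  "sets (history \<Omega> S Y t) = sigma_sets \<Omega> (\<Union>s\<in>{0..t}. {Y s -` A \<inter> \<Omega> | A. A \<in> sets S})"
  unfolding history_def by (rule sets_measure_of) auto

lemma vimage_in_history:
  assumes "0 \<le> s" "s \<le> t" "A \<in> sets S"
  shows "Y s -` A \<inter> \<Omega> \<in> sets (history \<Omega> S Y t)"
  unfolding sets_history using assms by (intro sigma_sets.Basic UN_I[of s]) auto

lemma subalgebra_history:
  assumes "\<And>s. 0 \<le> s \<Longrightarrow> s \<le> t \<Longrightarrow> Y s \<in> M \<rightarrow>\<^sub>M S"
  shows "subalgebra M (history (space M) S Y t)"
  unfolding subalgebra_def sets_history using assms
  by (auto intro!: sets.sigma_sets_subset measurable_sets)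

lemma simple_random_walk_measurable:
  assumes "simple_random_walk M x Y" "0 \<le> t"
  shows "Y t \<in> M \<rightarrow>\<^sub>M count_space UNIV"
  using assms by (auto simp: simple_random_walk_def)

text \<open>
  The Markov property in elementary form.  The defining conditional expectation is integrated over an
  event \<open>A\<close> of the past on which the present position has the fixed value \<open>b\<close>.
\<close>

lemma simple_random_walk_step:
  assumes W: "simple_random_walk M x Y" and st: "0 \<le> s" "s \<le> t"
    and A: "A \<in> sets (history (space M) (count_space UNIV) Y s)"
    and Ab: "\<And>\<omega>. \<omega> \<in> A \<Longrightarrow> Y s \<omega> = b"
  shows "measure M (A \<inter> {\<omega> \<in> space M. Y t \<omega> = c}) = measure M A * rw_transition (t - s) b c"
proof -
  interpret prob_space M
    using W by (simp add: simple_random_walk_def)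
  let ?H = "history (space M) (count_space UNIV) Y s"
  have sub: "subalgebra M ?H"
    using W by (intro subalgebra_history) (auto simp: simple_random_walk_def)
  then interpret finite_measure_subalgebra M ?H
    by unfold_locales
  have Yt[measurable]: "Y t \<in> M \<rightarrow>\<^sub>M count_space UNIV"
    using simple_random_walk_measurable[OF W] st by simp
  have AM[measurable]: "A \<in> sets M"
    using A sub by (auto simp: subalgebra_def)
  have [measurable]: "(\<lambda>\<omega>. indicator {c} (Y t \<omega>) :: real) \<in> borel_measurable M"
    by (rule measurable_compose[OF Yt]) simp
  have "measure M (A \<inter> {\<omega> \<in> space M. Y t \<omega> = c}) =
      (\<integral>\<omega>. indicator (A \<inter> {\<omega> \<in> space M. Y t \<omega> = c}) \<omega> \<partial>M)"
    by simp
  also have "\<dots> = (\<integral>\<omega>\<in>A. indicator {c} (Y t \<omega>) \<partial>M)"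
    unfolding set_lebesgue_integral_def
    by (intro Bochner_Integration.integral_cong) (auto simp: indicator_def)
  also have "\<dots> = (\<integral>\<omega>\<in>A. real_cond_exp M ?H (\<lambda>\<omega>. indicator {c} (Y t \<omega>)) \<omega> \<partial>M)"
    by (intro real_cond_exp_intA A integrable_const_bound[where B = 1]) auto
  also have "\<dots> = (\<integral>\<omega>\<in>A. rw_transition (t - s) b c \<partial>M)"
  proof (rule set_lebesgue_integral_cong_AE)
    have "AE \<omega> in M. real_cond_exp M ?H (\<lambda>\<omega>. indicator {c} (Y t \<omega>)) \<omega> = rw_transition (t - s) (Y s \<omega>) c"
      using W st by (simp add: simple_random_walk_def)
    then show "AE \<omega>\<in>A in M. real_cond_exp M ?H (\<lambda>\<omega>. indicator {c} (Y t \<omega>)) \<omega> = rw_transition (t - s) b c"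
      by eventually_elim (use Ab in auto)
  qed auto
  also have "\<dots> = measure M A * rw_transition (t - s) b c"
    by (simp add: set_lebesgue_integral_def mult.commute)
  finally show ?thesis .
qed

lemma simple_random_walk_fdd:
  assumes W: "simple_random_walk M x Y" and s: "s 0 = 0" "\<And>i. i < m \<Longrightarrow> s i \<le> s (Suc i)"
  shows "measure M {\<omega> \<in> space M. \<forall>i\<le>m. Y (s i) \<omega> = y i} =
    (if y 0 = x then 1 else 0) * (\<Prod>i<m. rw_transition (s (Suc i) - s i) (y i) (y (Suc i)))"
  using s(2)
proof (induction m)
  case 0
  interpret prob_space M
    using W by (simp add: simple_random_walk_def)
  have ae: "AE \<omega> in M. Y 0 \<omega> = x"
    using W by (simp add: simple_random_walk_def)
  have [measurable]: "Y 0 \<in> M \<rightarrow>\<^sub>M count_space UNIV"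
    using simple_random_walk_measurable[OF W] by simp
  show ?case
  proof (cases "y 0 = x")
    case True
    then have "prob {\<omega> \<in> space M. Y 0 \<omega> = y 0} = 1"
      using ae by (intro prob_Collect_eq_1[THEN iffD2]) auto
    then show ?thesis
      using True s(1) by simp
  next
    case False
    then have "prob {\<omega> \<in> space M. Y 0 \<omega> = y 0} = 0"
      using ae by (intro prob_Collect_eq_0[THEN iffD2]) auto
    then show ?thesis
      using False s(1) by simp
  qed
next
  case (Suc m)
  let ?A = "{\<omega> \<in> space M. \<forall>i\<le>m. Y (s i) \<omega> = y i}"
  have mono: "s i \<le> s j" if "i \<le> j" "j \<le> Suc m" for i j
    using that
  proof (induction j rule: dec_induct)
    case (step k)
    then show ?case using Suc.prems[of k] by auto
  qed auto
  have "(\<Inter>i\<in>{..m}. Y (s i) -` {y i} \<inter> space M) \<in> sets (history (space M) (count_space UNIV) Y (s m))"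
    using mono[of 0] mono[of _ m] s(1) by (intro sets.finite_INT vimage_in_history) auto
  also have "(\<Inter>i\<in>{..m}. Y (s i) -` {y i} \<inter> space M) = ?A"
    by auto
  finally have A: "?A \<in> sets (history (space M) (count_space UNIV) Y (s m))" .
  have "{\<omega> \<in> space M. \<forall>i\<le>Suc m. Y (s i) \<omega> = y i} = ?A \<inter> {\<omega> \<in> space M. Y (s (Suc m)) \<omega> = y (Suc m)}"
    by (auto simp: le_Suc_eq)
  also have "measure M \<dots> = measure M ?A * rw_transition (s (Suc m) - s m) (y m) (y (Suc m))"
    using mono[of 0 m] mono[of m "Suc m"] s(1) by (intro simple_random_walk_step[OF W _ _ A]) auto
  finally show ?case
    using Suc by simp
qed

lemma simple_random_walk_marginal:
  assumes W: "simple_random_walk M x Y" and t: "0 \<le> t"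
  shows "measure M {\<omega> \<in> space M. Y t \<omega> = y} = rw_transition t x y"
proof -
  interpret prob_space M
    using W by (simp add: simple_random_walk_def)
  have ae: "AE \<omega> in M. Y 0 \<omega> = x"
    using W by (simp add: simple_random_walk_def)
  have [measurable]: "Y 0 \<in> M \<rightarrow>\<^sub>M count_space UNIV" "Y t \<in> M \<rightarrow>\<^sub>M count_space UNIV"
    using simple_random_walk_measurable[OF W] t by simp_all
  have A: "Y 0 -` {x} \<inter> space M \<in> sets (history (space M) (count_space UNIV) Y 0)"
    by (intro vimage_in_history) auto
  have "measure M {\<omega> \<in> space M. Y t \<omega> = y} =
      measure M ((Y 0 -` {x} \<inter> space M) \<inter> {\<omega> \<in> space M. Y t \<omega> = y})"
    using ae by (intro measure_eq_AE) auto
  also have "\<dots> = measure M (Y 0 -` {x} \<inter> space M) * rw_transition (t - 0) x y"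
    using t by (intro simple_random_walk_step[OF W _ _ A]) auto
  also have "measure M (Y 0 -` {x} \<inter> space M) = 1"
    using ae prob_Collect_eq_1[of "\<lambda>\<omega>. Y 0 \<omega> = x"] by (simp add: vimage_def Collect_conj_eq Int_commute)
  finally show ?thesis
    by simp
qed

text \<open>
  Summing the two-time probabilities over the position at time \<open>s\<close>: by translation invariance the
  transition probability does not depend on it.
\<close>

lemma simple_random_walk_increment:
  assumes W: "simple_random_walk M x Y" and st: "0 \<le> s" "s \<le> t"
  shows "measure M {\<omega> \<in> space M. Y t \<omega> - Y s \<omega> = e} = rw_transition (t - s) 0 e"
proof -
  interpret prob_space M
    using W by (simp add: simple_random_walk_def)
  have [measurable]: "Y s \<in> M \<rightarrow>\<^sub>M count_space UNIV" "Y t \<in> M \<rightarrow>\<^sub>M count_space UNIV"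
    using simple_random_walk_measurable[OF W] st by simp_all
  let ?A = "\<lambda>b. Y s -` {b} \<inter> space M"
  have step: "measure M (?A b \<inter> {\<omega> \<in> space M. Y t \<omega> = b + e}) = measure M (?A b) * rw_transition (t - s) 0 e" for b
    using simple_random_walk_step[OF W st, of "?A b" b "b + e"] st
      rw_transition_shift[of "t - s" 0 b e]
    by (simp add: vimage_in_history add.commute)
  have p0: "0 \<le> rw_transition (t - s) 0 e"
    using simple_random_walk_marginal[OF W, of "t - s" "x + e"] st
      rw_transition_shift[of "t - s" 0 x e] measure_nonneg[of M] by (metis add.commute add_0 diff_ge_0_iff_ge)
  have "emeasure M {\<omega> \<in> space M. Y t \<omega> - Y s \<omega> = e} =
      emeasure M (\<Union>b\<in>UNIV. ?A b \<inter> {\<omega> \<in> space M. Y t \<omega> = b + e})"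
    by (intro arg_cong2[where f = emeasure]) auto
  also have "\<dots> = (\<integral>\<^sup>+b. emeasure M (?A b \<inter> {\<omega> \<in> space M. Y t \<omega> = b + e}) \<partial>count_space UNIV)"
    by (intro emeasure_UN_countable) (auto simp: disjoint_family_on_def)
  also have "\<dots> = (\<integral>\<^sup>+b. emeasure M (?A b) * ennreal (rw_transition (t - s) 0 e) \<partial>count_space UNIV)"
    by (simp add: emeasure_eq_measure step  ennreal_mult')
  also have "\<dots> = (\<integral>\<^sup>+b. emeasure M (?A b) \<partial>count_space UNIV) * ennreal (rw_transition (t - s) 0 e)"
    by (intro nn_integral_multc) auto
  also have "(\<integral>\<^sup>+b. emeasure M (?A b) \<partial>count_space UNIV) = emeasure M (\<Union>b\<in>UNIV. ?A b)"
    by (intro emeasure_UN_countable[symmetric]) (auto simp: disjoint_family_on_def)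
  also have "(\<Union>b\<in>UNIV. ?A b) = space M"
    by auto
  finally show ?thesis
    by (simp add: emeasure_space_1 emeasure_eq_measure p0 prob_space)
qed

text \<open>
  Not moving and moving by exactly one have, to first order in \<open>d\<close>, the probabilities \<open>1 - d\<close> and \<open>d / 2\<close>
  in each direction, which add up to one; a larger move must be paid for by the second-order errors.
\<close>

lemma small_increment_probabilities:
  assumes W: "simple_random_walk M x Y" and st: "0 \<le> s" "s \<le> t" "t \<le> T"
  defines "d \<equiv> t - s"
  shows "measure M {\<omega> \<in> space M. Y t \<omega> \<noteq> Y s \<omega>} \<le> d + 4 * d\<^sup>2 * exp (2 * T)"
    and "measure M {\<omega> \<in> space M. 2 \<le> \<bar>Y t \<omega> - Y s \<omega>\<bar>} \<le> 12 * d\<^sup>2 * exp (2 * T)"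
proof -
  interpret prob_space M
    using W by (simp add: simple_random_walk_def)
  have [measurable]: "Y s \<in> M \<rightarrow>\<^sub>M count_space UNIV" "Y t \<in> M \<rightarrow>\<^sub>M count_space UNIV"
    using simple_random_walk_measurable[OF W] st by simp_all
  define D where "D e = {\<omega> \<in> space M. Y t \<omega> - Y s \<omega> = e}" for e
  have D[measurable]: "D e \<in> sets M" for e
    unfolding D_def by measurable
  define r where "r = 4 * d\<^sup>2 * exp (2 * T)"
  have d: "0 \<le> d" "d \<le> T"
    using st by (auto simp: d_def)
  have r: "\<bar>rw_transition d 0 e - (indicator {e} 0 + d * L1 (indicator {e}) 0)\<bar> \<le> r" for e
  proof -
    have "(2 * d)\<^sup>2 * exp (2 * d) \<le> (2 * d)\<^sup>2 * exp (2 * T)"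
      using d by (intro mult_left_mono) auto
    then show ?thesis
      using rw_transition_short_time[OF d(1), of 0 e] by (simp add: r_def power_mult_distrib)
  qed
  have p: "prob (D e) = rw_transition d 0 e" for e
    unfolding D_def d_def by (rule simple_random_walk_increment[OF W st(1,2)])
  have p0: "1 - d - r \<le> prob (D 0)"
    using r[of 0] by (simp add: p L1_def indicator_def)
  have p1: "d / 2 - r \<le> prob (D 1)" "d / 2 - r \<le> prob (D (- 1))"
    using r[of 1] r[of "- 1"] by (simp_all add: p L1_def indicator_def abs_le_iff)
  have "prob {\<omega> \<in> space M. Y t \<omega> \<noteq> Y s \<omega>} = prob (space M - D 0)"
    by (intro arg_cong[where f = prob]) (auto simp: D_def)
  also have "\<dots> = 1 - prob (D 0)"
    by (rule prob_compl[OF D])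
  finally show "prob {\<omega> \<in> space M. Y t \<omega> \<noteq> Y s \<omega>} \<le> d + 4 * d\<^sup>2 * exp (2 * T)"
    using p0 by (simp add: r_def)
  have "prob {\<omega> \<in> space M. 2 \<le> \<bar>Y t \<omega> - Y s \<omega>\<bar>} = prob (space M - (D 0 \<union> (D 1 \<union> D (- 1))))"
    by (intro arg_cong[where f = prob]) (auto simp: D_def)
  also have "\<dots> = 1 - prob (D 0 \<union> (D 1 \<union> D (- 1)))"
    by (rule prob_compl) measurable
  also have "prob (D 0 \<union> (D 1 \<union> D (- 1))) = prob (D 0) + prob (D 1 \<union> D (- 1))"
    by (rule finite_measure_Union) (auto simp: D_def[of 0] D_def[of 1] D_def[of "- 1"])
  also have "prob (D 1 \<union> D (- 1)) = prob (D 1) + prob (D (- 1))"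
    by (rule finite_measure_Union) (auto simp: D_def)
  finally show "prob {\<omega> \<in> space M. 2 \<le> \<bar>Y t \<omega> - Y s \<omega>\<bar>} \<le> 12 * d\<^sup>2 * exp (2 * T)"
    using p0 p1 by (simp add: r_def)
qed

text \<open>
  It suffices to bound the expectation of \<open>exp \<bar>Y t - x\<bar>\<close>, which dominates every power; it is finite
  because \<open>\<bar>Y t - x\<bar> = n\<close> has probability of order \<open>exp (- 2 n)\<close>.
\<close>

lemma integrable_walk_power:
  assumes W: "simple_random_walk M x Y" and t: "0 \<le> t"
  shows "integrable M (\<lambda>\<omega>. (1 + \<bar>real_of_int (Y t \<omega>)\<bar>) ^ q)"
proof -
  interpret prob_space M
    using W by (simp add: simple_random_walk_def)
  have Yt[measurable]: "Y t \<in> M \<rightarrow>\<^sub>M count_space UNIV"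
    by (rule simple_random_walk_measurable[OF W t])
  have meas[measurable]: "(\<lambda>\<omega>. g (Y t \<omega>) :: real) \<in> borel_measurable M" for g
    by (rule measurable_compose[OF Yt]) simp
  define A where "A n = {\<omega> \<in> space M. nat \<bar>Y t \<omega> - x\<bar> = n}" for n
  have A[measurable]: "A n \<in> sets M" for n
    unfolding A_def by measurable
  define K where "K = 2 * exp (2 * exp 2 * t)"
  have PA: "prob (A n) \<le> K * exp (- 2 * real n)" for n
  proof -
    have "prob (A n) \<le> prob ({\<omega> \<in> space M. Y t \<omega> = x + int n} \<union> {\<omega> \<in> space M. Y t \<omega> = x - int n})"
      by (intro finite_measure_mono) (auto simp: A_def)
    also have "\<dots> \<le> prob {\<omega> \<in> space M. Y t \<omega> = x + int n} + prob {\<omega> \<in> space M. Y t \<omega> = x - int n}"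
      by (rule measure_Un_le) measurable
    also have "\<dots> \<le> K * exp (- 2 * real n)"
      using rw_transition_exp_bound[OF t, of x "x + int n"] rw_transition_exp_bound[OF t, of x "x - int n"]
      by (simp add: simple_random_walk_marginal[OF W t] K_def)
    finally show ?thesis .
  qed
  have exp_int: "(\<integral>\<^sup>+\<omega>. ennreal (exp \<bar>real_of_int (Y t \<omega> - x)\<bar>) \<partial>M) < \<infinity>"
  proof -
    have "(\<integral>\<^sup>+\<omega>. ennreal (exp \<bar>real_of_int (Y t \<omega> - x)\<bar>) \<partial>M) =
        (\<integral>\<^sup>+\<omega>. (\<Sum>n. ennreal (exp (real n)) * indicator (A n) \<omega>) \<partial>M)"
    proof (rule nn_integral_cong)
      fix \<omega> assume "\<omega> \<in> space M"
      then show "ennreal (exp \<bar>real_of_int (Y t \<omega> - x)\<bar>) = (\<Sum>n. ennreal (exp (real n)) * indicator (A n) \<omega>)"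
        by (subst suminf_cmult_indicator[where i = "nat \<bar>Y t \<omega> - x\<bar>"])
           (auto simp: A_def disjoint_family_on_def)
    qed
    also have "\<dots> = (\<Sum>n. \<integral>\<^sup>+\<omega>. ennreal (exp (real n)) * indicator (A n) \<omega> \<partial>M)"
      by (rule nn_integral_suminf) measurable
    also have "\<dots> = (\<Sum>n. ennreal (exp (real n) * prob (A n)))"
      by (simp add: nn_integral_cmult_indicator emeasure_eq_measure ennreal_mult')
    also have "\<dots> \<le> (\<Sum>n. ennreal (K * exp (- 1) ^ n))"
    proof (intro suminf_le ennreal_leI)
      fix n
      have "exp (real n) * prob (A n) \<le> exp (real n) * (K * exp (- 2 * real n))"
        using PA by (intro mult_left_mono) auto
      also have "\<dots> = K * exp (- 1) ^ n"
        by (simp add: exp_of_nat_mult[symmetric] exp_add[symmetric] mult.left_commute[of _ K])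
      finally show "exp (real n) * prob (A n) \<le> K * exp (- 1) ^ n" .
    qed auto
    also have "\<dots> < \<infinity>"
      by (subst suminf_ennreal2) (auto simp: K_def intro!: summable_mult summable_geometric)
    finally show ?thesis .
  qed
  have "integrable M (\<lambda>\<omega>. exp \<bar>real_of_int (Y t \<omega> - x)\<bar>)"
    by (rule integrableI_nonneg) (use exp_int in auto)
  then have "integrable M (\<lambda>\<omega>. fact q * exp (1 + \<bar>real_of_int x\<bar>) * exp \<bar>real_of_int (Y t \<omega> - x)\<bar>)"
    by (rule integrable_mult_right)
  then show ?thesis
  proof (rule Bochner_Integration.integrable_bound)
    show "AE \<omega> in M. norm ((1 + \<bar>real_of_int (Y t \<omega>)\<bar>) ^ q) \<le>
        norm (fact q * exp (1 + \<bar>real_of_int x\<bar>) * exp \<bar>real_of_int (Y t \<omega> - x)\<bar>)"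
    proof (rule AE_I2)
      fix \<omega>
      have "(1 + \<bar>real_of_int (Y t \<omega>)\<bar>) ^ q \<le> fact q * exp (1 + \<bar>real_of_int (Y t \<omega>)\<bar>)"
        by (rule power_le_fact_exp) auto
      also have "\<dots> \<le> fact q * exp (1 + \<bar>real_of_int x\<bar> + \<bar>real_of_int (Y t \<omega> - x)\<bar>)"
        by (intro mult_left_mono) auto
      finally show "norm ((1 + \<bar>real_of_int (Y t \<omega>)\<bar>) ^ q) \<le>
          norm (fact q * exp (1 + \<bar>real_of_int x\<bar>) * exp \<bar>real_of_int (Y t \<omega> - x)\<bar>)"
        by (simp add: exp_add mult_ac)
    qed
  qed (rule meas)
qed

section \<open>Exchanging labels after a collision on a time grid\<close>

lemma h_weyl_eq_det: "h_weyl N x = Determinant.det (vandermonde_mat N x)"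
  unfolding det_vandermonde h_weyl_def ..

text \<open>
  Exchanging two coordinates exchanges two rows of the Vandermonde matrix.
\<close>

lemma h_weyl_transpose:
  assumes "a < N" "b < N" "a \<noteq> b"
  shows "h_weyl N (x \<circ> Transposition.transpose a b) = - h_weyl N x"
proof -
  have "vandermonde_mat N (x \<circ> Transposition.transpose a b) = swaprows a b (vandermonde_mat N x)"
    using assms by (intro eq_matI) (auto simp: vandermonde_mat_def Transposition.transpose_def)
  then show ?thesis
    using det_swaprows[OF assms, of "vandermonde_mat N x"]
    by (simp add: h_weyl_eq_det vandermonde_mat_def)
qed

definition collision :: "nat \<Rightarrow> (nat \<Rightarrow> int) \<Rightarrow> nat \<times> nat \<Rightarrow> bool" where
  "collision N x = (\<lambda>(a, b). a < b \<and> b < N \<and> x a = x b)"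

text \<open>
  Several pairs of walkers may collide at once.  The choice of a pair depends on the configuration \<open>x\<close>
  alone, and \<open>x\<close> is fixed by the exchange, so carrying out the exchange twice gives the identity.
\<close>

definition swap_colliding :: "nat \<Rightarrow> (nat \<Rightarrow> int) \<Rightarrow> nat \<Rightarrow> nat" where
  "swap_colliding N x =
     (if \<exists>p. collision N x p then (case SOME p. collision N x p of (a, b) \<Rightarrow> Transposition.transpose a b) else id)"

lemma swap_colliding_cases:
  obtains a b where "a < b" "b < N" "x a = x b" "swap_colliding N x = Transposition.transpose a b"
  | "swap_colliding N x = id" "\<And>p. \<not> collision N x p"
proof (cases "\<exists>p. collision N x p")
  case True
  then have "collision N x (SOME p. collision N x p)"
    by (rule someI_ex)
  then show ?thesis
    using True that(1) by (cases "SOME p. collision N x p") (auto simp: swap_colliding_def collision_def)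
next
  case False
  then show ?thesis
    using that(2) by (auto simp: swap_colliding_def)
qed

lemma swap_colliding_fixes: "x \<circ> swap_colliding N x = x"
  by (cases N x rule: swap_colliding_cases) (auto simp: Transposition.transpose_def)

lemma swap_colliding_invol: "swap_colliding N x \<circ> swap_colliding N x = id"
  by (cases N x rule: swap_colliding_cases) auto

lemma swap_colliding_permutes: "swap_colliding N x permutes {..<N}"
  by (cases N x rule: swap_colliding_cases) (auto intro!: permutes_swap_id permutes_id)

text \<open>
  The possible positions at the grid times \<open>0, ..., m\<close>.  Functions are extensional in both arguments, which makes
  this set countable; measures on it are then determined by the masses of points.
\<close>

definition skeletons :: "nat \<Rightarrow> nat \<Rightarrow> (nat \<Rightarrow> nat \<Rightarrow> int) set" where
  "skeletons N m = PiE {..m} (\<lambda>_. PiE {..<N} (\<lambda>_. UNIV))"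

definition skeleton :: "nat \<Rightarrow> (nat \<Rightarrow> real) \<Rightarrow> nat \<Rightarrow> (real \<Rightarrow> 'a \<Rightarrow> nat \<Rightarrow> int) \<Rightarrow> 'a \<Rightarrow> nat \<Rightarrow> nat \<Rightarrow> int" where
  "skeleton N s m V \<omega> = (\<lambda>i\<in>{..m}. \<lambda>j\<in>{..<N}. V (s i) \<omega> j)"

text \<open>
  The reflection map: from the grid time \<open>i\<^sub>0\<close> on, the labels of a pair that collides at \<open>i\<^sub>0\<close> are
  exchanged.  At \<open>i\<^sub>0\<close> itself this changes nothing, so starting at \<open>i\<^sub>0\<close> or just after it is the same.
\<close>

definition swap_after :: "nat \<Rightarrow> nat \<Rightarrow> nat \<Rightarrow> (nat \<Rightarrow> nat \<Rightarrow> int) \<Rightarrow> nat \<Rightarrow> nat \<Rightarrow> int" where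
  "swap_after N m i\<^sub>0 v = (\<lambda>i. if i\<^sub>0 \<le> i \<and> i \<le> m then v i \<circ> swap_colliding N (v i\<^sub>0) else v i)"

lemma skeleton_in: "skeleton N s m V \<omega> \<in> skeletons N m"
  by (auto simp: skeleton_def skeletons_def)

lemma countable_skeletons: "countable (skeletons N m)"
  unfolding skeletons_def by (intro countable_PiE) auto

lemma swap_after_before: "i \<le> i\<^sub>0 \<Longrightarrow> swap_after N m i\<^sub>0 v i = v i"
  by (cases "i = i\<^sub>0") (auto simp: swap_after_def swap_colliding_fixes)

lemma swap_after_in:
  assumes "v \<in> skeletons N m"
  shows "swap_after N m i\<^sub>0 v \<in> skeletons N m"
proof -
  have "v i \<circ> swap_colliding N (v i\<^sub>0) \<in> PiE {..<N} (\<lambda>_. UNIV)" if "i \<le> m" for i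
  proof (rule PiE_I)
    fix j assume "j \<notin> {..<N}"
    then show "(v i \<circ> swap_colliding N (v i\<^sub>0)) j = undefined"
      using assms that permutes_not_in[OF swap_colliding_permutes]
      by (auto simp: skeletons_def PiE_def extensional_def)
  qed auto
  then show ?thesis
    using assms by (auto simp: skeletons_def swap_after_def PiE_iff extensional_def)
qed

lemma swap_after_invol: "swap_after N m i\<^sub>0 (swap_after N m i\<^sub>0 v) = v"
proof
  fix i
  show "swap_after N m i\<^sub>0 (swap_after N m i\<^sub>0 v) i = v i"
    using swap_colliding_invol[of N "v i\<^sub>0"]
    by (simp add: swap_after_def[of N m i\<^sub>0 "swap_after N m i\<^sub>0 v"] swap_after_before)
       (simp add: swap_after_def comp_assoc)
qed

definition skeleton_weight :: "nat \<Rightarrow> (nat \<Rightarrow> int) \<Rightarrow> (nat \<Rightarrow> real) \<Rightarrow> nat \<Rightarrow> (nat \<Rightarrow> nat \<Rightarrow> int) \<Rightarrow> real" where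
  "skeleton_weight N u s m v = (\<Prod>j<N. (if v 0 j = u j then 1 else 0) *
     (\<Prod>i<m. rw_transition (s (Suc i) - s i) (v i j) (v (Suc i) j)))"

text \<open>
  The weight is a product over the walkers of a product over the steps.  Steps before \<open>i\<^sub>0\<close> are unchanged; each later
  step has the labels of both its end points permuted in the same way, which only reorders the
  product over the walkers.
\<close>

lemma skeleton_weight_swap:
  assumes "i\<^sub>0 \<le> m"
  shows "skeleton_weight N u s m (swap_after N m i\<^sub>0 v) = skeleton_weight N u s m v"
proof -
  let ?w = "swap_after N m i\<^sub>0 v" and ?\<tau> = "swap_colliding N (v i\<^sub>0)"
  have step: "(\<Prod>j<N. rw_transition d (?w i j) (?w (Suc i) j)) = (\<Prod>j<N. rw_transition d (v i j) (v (Suc i) j))"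
    if "i < m" for i d
  proof (cases "i\<^sub>0 \<le> i")
    case True
    then show ?thesis
      using that prod.permute[OF swap_colliding_permutes[of N "v i\<^sub>0"], of "\<lambda>j. rw_transition d (v i j) (v (Suc i) j)"]
      by (simp add: swap_after_def o_def)
  next
    case False
    then show ?thesis
      by (simp add: swap_after_before)
  qed
  show ?thesis
    unfolding skeleton_weight_def prod.distrib
    by (subst (1 2) prod.swap) (simp add: step swap_after_before)
qed

lemma independent_walks_walk:
  assumes "independent_walks N u M V" "j < N"
  shows "simple_random_walk M (u j) (\<lambda>t \<omega>. V t \<omega> j)"
  using assms by (simp add: independent_walks_def)

lemma independent_walks_measurable:
  assumes "independent_walks N u M V" "j < N" "0 \<le> t"
  shows "(\<lambda>\<omega>. V t \<omega> j) \<in> M \<rightarrow>\<^sub>M count_space UNIV"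
  using simple_random_walk_measurable[OF independent_walks_walk[OF assms(1,2)] assms(3)] .

lemma time_grid_mono:
  fixes s :: "nat \<Rightarrow> real"
  assumes "\<And>i. i < m \<Longrightarrow> s i \<le> s (Suc i)" "i \<le> j" "j \<le> m"
  shows "s i \<le> s j"
  using assms(2,3)
proof (induction j rule: dec_induct)
  case (step k)
  then show ?case using assms(1)[of k] by auto
qed auto

text \<open>
  Independence of the walkers gives the outer product, the Markov property of each walker the inner one.
\<close>

lemma skeleton_distribution:
  assumes IW: "independent_walks N u M V" and N: "1 \<le> N"
    and s: "s 0 = 0" "\<And>i. i < m \<Longrightarrow> s i \<le> s (Suc i)"
    and v: "v \<in> skeletons N m"
  shows "measure M {\<omega> \<in> space M. skeleton N s m V \<omega> = v} = skeleton_weight N u s m v"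
proof -
  interpret prob_space M
    using IW by (simp add: independent_walks_def)
  have s0: "0 \<le> s i" if "i \<le> m" for i
    using time_grid_mono[of m s 0 i, OF s(2)] that s(1) by simp
  let ?P = "PiM {0..} (\<lambda>_. count_space UNIV) :: (real \<Rightarrow> int) measure"
  define A where "A j = (\<Inter>i\<in>{..m}. (\<lambda>y. y (s i)) -` {v i j} \<inter> space ?P)" for j
  have A: "A j \<in> sets ?P" for j
    unfolding A_def
    by (intro sets.finite_INT measurable_sets[OF measurable_component_singleton]) (auto simp: s0)
  have pre: "(\<lambda>\<omega>. \<lambda>t\<in>{0..}. V t \<omega> j) -` A j \<inter> space M = {\<omega> \<in> space M. \<forall>i\<le>m. V (s i) \<omega> j = v i j}" for j
    using s0 by (auto simp: A_def space_PiM)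
  have "{\<omega> \<in> space M. skeleton N s m V \<omega> = v} = (\<Inter>j\<in>{..<N}. {\<omega> \<in> space M. \<forall>i\<le>m. V (s i) \<omega> j = v i j})"
  proof -
    have "skeleton N s m V \<omega> = v \<longleftrightarrow> (\<forall>j<N. \<forall>i\<le>m. V (s i) \<omega> j = v i j)" for \<omega>
    proof
      assume "skeleton N s m V \<omega> = v"
      then show "\<forall>j<N. \<forall>i\<le>m. V (s i) \<omega> j = v i j"
        by (auto simp: skeleton_def)
    next
      assume *: "\<forall>j<N. \<forall>i\<le>m. V (s i) \<omega> j = v i j"
      show "skeleton N s m V \<omega> = v"
      proof (rule PiE_ext[OF skeleton_in[unfolded skeletons_def] v[unfolded skeletons_def]])
        fix i assume i: "i \<in> {..m}"
        then have "v i \<in> PiE {..<N} (\<lambda>_. UNIV)"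
          using v by (auto simp: skeletons_def)
        then show "skeleton N s m V \<omega> i = v i"
          using * i by (intro ext) (auto simp: skeleton_def PiE_def extensional_def)
      qed
    qed
    then show ?thesis
      using N by (auto simp: Suc_le_eq)
  qed
  also have "prob \<dots> = (\<Prod>j\<in>{..<N}. prob ((\<lambda>\<omega>. \<lambda>t\<in>{0..}. V t \<omega> j) -` A j \<inter> space M))"
    unfolding pre[symmetric]
  proof (rule indep_varsD_finite)
    show "indep_vars (\<lambda>j. ?P) (\<lambda>j \<omega>. \<lambda>t\<in>{0..}. V t \<omega> j) {..<N}"
      using IW by (simp add: independent_walks_def)
  qed (use N A in \<open>auto simp: lessThan_empty_iff\<close>)
  also have "\<dots> = skeleton_weight N u s m v"
    unfolding skeleton_weight_def pre
    by (intro prod.cong refl simple_random_walk_fdd[OF independent_walks_walk[OF IW]])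
       (use s in auto)
  finally show ?thesis .
qed

lemma skeleton_measurable:
  assumes IW: "independent_walks N u M V"
    and s0: "\<And>i. i \<le> m \<Longrightarrow> 0 \<le> s i"
  shows "skeleton N s m V \<in> M \<rightarrow>\<^sub>M count_space (skeletons N m)"
proof (rule measurable_count_space_eq_countable[THEN iffD2])
  show "countable (skeletons N m)"
    by (rule countable_skeletons)
  have "skeleton N s m V -` {v} \<inter> space M \<in> sets M" if v: "v \<in> skeletons N m" for v
  proof -
    have [measurable]: "(\<lambda>\<omega>. V (s i) \<omega> j) \<in> M \<rightarrow>\<^sub>M count_space UNIV" if "i \<le> m" "j < N" for i j
      using independent_walks_measurable[OF IW] that s0 by simp
    have "skeleton N s m V -` {v} \<inter> space M = {\<omega> \<in> space M. \<forall>i\<in>{..m}. \<forall>j\<in>{..<N}. V (s i) \<omega> j = v i j}"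
    proof (intro Set.set_eqI iffI)
      fix \<omega> assume "\<omega> \<in> {\<omega> \<in> space M. \<forall>i\<in>{..m}. \<forall>j\<in>{..<N}. V (s i) \<omega> j = v i j}"
      then have "skeleton N s m V \<omega> i = v i" if "i \<le> m" for i
        using v that by (intro ext) (auto simp: skeleton_def skeletons_def PiE_iff extensional_def)
      then have "skeleton N s m V \<omega> = v"
        using v by (intro PiE_ext[OF skeleton_in[unfolded skeletons_def]]) (auto simp: skeletons_def)
      then show "\<omega> \<in> skeleton N s m V -` {v} \<inter> space M"
        using \<open>\<omega> \<in> _\<close> by auto
    qed (auto simp: skeleton_def)
    also have "\<dots> \<in> sets M"
      by measurable
    finally show ?thesis .
  qed
  then show "skeleton N s m V \<in> space M \<rightarrow> skeletons N m \<and>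
      (\<forall>v\<in>skeletons N m. skeleton N s m V -` {v} \<inter> space M \<in> sets M)"
    by (auto intro: skeleton_in)
qed

text \<open>
  The reflection principle on the grid: the reflection map is an involution of a countable set that
  preserves the masses of points, hence preserves the law of the skeleton.
\<close>

proposition skeleton_swap_invariance:
  fixes \<phi> :: "(nat \<Rightarrow> nat \<Rightarrow> int) \<Rightarrow> real"
  assumes IW: "independent_walks N u M V" and N: "1 \<le> N"
    and s: "s 0 = 0" "\<And>i. i < m \<Longrightarrow> s i \<le> s (Suc i)"
    and i\<^sub>0: "i\<^sub>0 \<le> m"
  shows "(\<integral>\<omega>. \<phi> (skeleton N s m V \<omega>) \<partial>M) = (\<integral>\<omega>. \<phi> (swap_after N m i\<^sub>0 (skeleton N s m V \<omega>)) \<partial>M)"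
proof -
  interpret prob_space M
    using IW by (simp add: independent_walks_def)
  let ?C = "count_space (skeletons N m)"
  define \<mu> where "\<mu> = distr M ?C (skeleton N s m V)"
  have sk[measurable]: "skeleton N s m V \<in> M \<rightarrow>\<^sub>M ?C"
    using time_grid_mono[of m s 0, OF s(2)] s(1) by (intro skeleton_measurable[OF IW]) auto
  have sw[measurable]: "swap_after N m i\<^sub>0 \<in> ?C \<rightarrow>\<^sub>M ?C"
    by (auto intro: swap_after_in)
  have weight: "emeasure \<mu> {v} = ennreal (skeleton_weight N u s m v)" if "v \<in> skeletons N m" for v
  proof -
    have "emeasure \<mu> {v} = emeasure M {\<omega> \<in> space M. skeleton N s m V \<omega> = v}"
      using that unfolding \<mu>_def
      by (subst emeasure_distr[OF sk]) (auto intro!: arg_cong2[where f = emeasure])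
    then show ?thesis
      using skeleton_distribution[OF IW N s that] by (simp add: emeasure_eq_measure)
  qed
  have "distr \<mu> ?C (swap_after N m i\<^sub>0) = \<mu>"
  proof (rule measure_eqI_countable[where A = "skeletons N m"])
    fix v assume v: "v \<in> skeletons N m"
    have "swap_after N m i\<^sub>0 -` {v} \<inter> skeletons N m = {swap_after N m i\<^sub>0 v}"
      using v by (auto simp: swap_after_invol swap_after_in)
    then show "emeasure (distr \<mu> ?C (swap_after N m i\<^sub>0)) {v} = emeasure \<mu> {v}"
      using v i\<^sub>0 by (subst emeasure_distr) (auto simp: \<mu>_def[THEN arg_cong[where f = space]] sw
          weight swap_after_in skeleton_weight_swap \<mu>_def[THEN arg_cong[where f = "\<lambda>\<mu>. measurable \<mu> _"]])
  qed (auto simp: \<mu>_def countable_skeletons)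
  then have "(\<integral>v. \<phi> v \<partial>\<mu>) = (\<integral>v. \<phi> v \<partial>distr \<mu> ?C (swap_after N m i\<^sub>0))"
    by simp
  also have "\<dots> = (\<integral>v. \<phi> (swap_after N m i\<^sub>0 v) \<partial>\<mu>)"
    by (rule integral_distr) (auto simp: \<mu>_def swap_after_in)
  finally show ?thesis
    unfolding \<mu>_def by (simp add: integral_distr[OF sk])
qed

section \<open>Moments of the Vandermonde product and double jumps\<close>

text \<open>
  The bound is a product over the walkers of functions of one coordinate, so that independence reduces the integrability of
  powers of \<open>h\<close> to that of powers of a single walk.
\<close>

lemma h_weyl_bound: "\<bar>h_weyl N (rvec x)\<bar> \<le> (\<Prod>j<N. (1 + \<bar>real_of_int (x j)\<bar>) ^ (2 * N))"
proof -
  let ?a = "\<lambda>j. 1 + \<bar>real_of_int (x j)\<bar>"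
  have "\<bar>h_weyl N (rvec x)\<bar> = (\<Prod>(j, k)\<in>{(j, k). j < k \<and> k < N}. \<bar>real_of_int (x k) - real_of_int (x j)\<bar>)"
    by (simp add: h_weyl_def rvec_def abs_prod case_prod_unfold)
  also have "\<dots> \<le> (\<Prod>(j, k)\<in>{(j, k). j < k \<and> k < N}. ?a j * ?a k)"
  proof (rule prod_mono, clarify)
    fix j k
    have "\<bar>real_of_int (x k) - real_of_int (x j)\<bar> \<le> 1 * ?a k + \<bar>real_of_int (x j)\<bar> * 1"
      by auto
    also have "\<dots> \<le> 1 * ?a k + \<bar>real_of_int (x j)\<bar> * ?a k"
      by (intro add_left_mono mult_left_mono) auto
    finally show "0 \<le> \<bar>real_of_int (x k) - real_of_int (x j)\<bar> \<and>
        \<bar>real_of_int (x k) - real_of_int (x j)\<bar> \<le> ?a j * ?a k"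
      by (simp add: distrib_right)
  qed
  also have "\<dots> \<le> (\<Prod>(j, k)\<in>{..<N} \<times> {..<N}. ?a j * ?a k)"
  proof (rule prod_mono2)
    fix p
    have "1 * 1 \<le> ?a j * ?a k" for j k
      by (rule mult_mono) auto
    then show "1 \<le> (case p of (j, k) \<Rightarrow> ?a j * ?a k)"
      by (cases p) auto
  qed auto
  also have "\<dots> = (\<Prod>j<N. \<Prod>k<N. ?a j * ?a k)"
    by (simp add: prod.cartesian_product)
  also have "\<dots> = (\<Prod>j<N. ?a j) ^ N * (\<Prod>j<N. ?a j) ^ N"
    by (simp add: prod.distrib prod_power_distrib)
  also have "\<dots> = (\<Prod>j<N. ?a j ^ (2 * N))"
    by (simp add: prod_power_distrib[symmetric] power_add[symmetric] mult_2)
  finally show ?thesis .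
qed

lemma h_weyl_measurable:
  assumes IW: "independent_walks N u M V" and t: "0 \<le> t"
  shows "(\<lambda>\<omega>. h_weyl N (rvec (V t \<omega>))) \<in> borel_measurable M"
proof -
  have "(\<lambda>\<omega>. real_of_int (V t \<omega> j)) \<in> borel_measurable M" if "j < N" for j
    by (rule measurable_compose[OF independent_walks_measurable[OF IW that t]]) simp
  then show ?thesis
    unfolding h_weyl_def rvec_def case_prod_unfold
    by (intro borel_measurable_prod borel_measurable_diff) auto
qed

lemma integrable_h_weyl_power:
  assumes IW: "independent_walks N u M V" and t: "0 \<le> t"
  shows "integrable M (\<lambda>\<omega>. h_weyl N (rvec (V t \<omega>)) ^ q)"
proof -
  interpret prob_space M
    using IW by (simp add: independent_walks_def)
  let ?Y = "\<lambda>j \<omega>. (1 + \<bar>real_of_int (V t \<omega> j)\<bar>) ^ (2 * N * q)"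
  have int: "indep_vars (\<lambda>j. PiM {0..} (\<lambda>_. count_space UNIV) :: (real \<Rightarrow> int) measure)
      (\<lambda>j \<omega>. \<lambda>t\<in>{0..}. V t \<omega> j) {..<N}"
    using IW by (simp add: independent_walks_def)
  have "indep_vars (\<lambda>_. borel)
      (\<lambda>j \<omega>. (1 + \<bar>real_of_int ((\<lambda>t\<in>{0..}. V t \<omega> j) t)\<bar>) ^ (2 * N * q)) {..<N}"
  proof (rule indep_vars_compose2[OF int])
    have "(\<lambda>y. y t) \<in> PiM {0..} (\<lambda>_. count_space UNIV :: int measure) \<rightarrow>\<^sub>M count_space UNIV"
      using t by (intro measurable_component_singleton) auto
    then show "(\<lambda>y. (1 + \<bar>real_of_int (y t)\<bar>) ^ (2 * N * q)) \<in> borel_measurable (PiM {0..} (\<lambda>_. count_space UNIV))"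
      by (rule measurable_compose) simp
  qed
  then have "indep_vars (\<lambda>_. borel) ?Y {..<N}"
    using t by simp
  then have "integrable M (\<lambda>\<omega>. \<Prod>j<N. ?Y j \<omega>)"
    using integrable_walk_power[OF independent_walks_walk[OF IW] t]
    by (intro indep_vars_integrable) auto
  then show ?thesis
  proof (rule Bochner_Integration.integrable_bound)
    show "AE \<omega> in M. norm (h_weyl N (rvec (V t \<omega>)) ^ q) \<le> norm (\<Prod>j<N. ?Y j \<omega>)"
    proof (rule AE_I2)
      fix \<omega>
      have "norm (h_weyl N (rvec (V t \<omega>)) ^ q) \<le> (\<Prod>j<N. (1 + \<bar>real_of_int (V t \<omega> j)\<bar>) ^ (2 * N)) ^ q"
        unfolding real_norm_def power_abs by (intro power_mono h_weyl_bound) auto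
      also have "\<dots> = (\<Prod>j<N. ?Y j \<omega>)"
        by (simp add: prod_power_distrib power_mult)
      finally show "norm (h_weyl N (rvec (V t \<omega>)) ^ q) \<le> norm (\<Prod>j<N. ?Y j \<omega>)"
        by simp
    qed
  qed (use h_weyl_measurable[OF IW t] in auto)
qed

definition double_jump :: "nat \<Rightarrow> (nat \<Rightarrow> int) \<Rightarrow> (nat \<Rightarrow> int) \<Rightarrow> bool" where
  "double_jump N x y \<longleftrightarrow> (\<exists>j<N. 2 \<le> \<bar>y j - x j\<bar>) \<or> (\<exists>j<N. \<exists>k<N. j \<noteq> k \<and> y j \<noteq> x j \<and> y k \<noteq> x k)"

text \<open>
  If \<open>x j < x k\<close> while \<open>y k < y j\<close>, the displacements of the two coordinates add up to at least two.
\<close>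

lemma exit_without_collision_double_jump:
  assumes "rvec x \<in> weyl_chamber N" "rvec y \<notin> weyl_chamber N" "\<not> (\<exists>p. collision N y p)"
  shows "double_jump N x y"
proof -
  obtain j k where jk: "j < k" "k < N" "y k \<le> y j"
    using assms(2) by (auto simp: weyl_chamber_def rvec_def not_less)
  moreover have "y j \<noteq> y k"
    using assms(3) jk by (auto simp: collision_def)
  moreover have "x j < x k"
    using assms(1) jk by (auto simp: weyl_chamber_def rvec_def)
  ultimately have "2 \<le> \<bar>y j - x j\<bar> \<or> 2 \<le> \<bar>y k - x k\<bar> \<or> y j \<noteq> x j \<and> y k \<noteq> x k"
    by linarith
  then show ?thesis
    using jk unfolding double_jump_def by (metis less_trans less_irrefl)
qed

text \<open>
  The first summand counts moves of a single walker by two or more, the second simultaneous moves of two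
  different walkers.
\<close>

definition double_jump_const :: "nat \<Rightarrow> real \<Rightarrow> real" where
  "double_jump_const N T = real N * (12 * exp (2 * T)) + (real N)\<^sup>2 * (1 + 4 * T * exp (2 * T))\<^sup>2"

lemma double_jump_probability:
  assumes IW: "independent_walks N u M V" and st: "0 \<le> s" "s \<le> t" "t \<le> T"
  shows "measure M {\<omega> \<in> space M. double_jump N (V s \<omega>) (V t \<omega>)} \<le> double_jump_const N T * (t - s)\<^sup>2"
proof -
  interpret prob_space M
    using IW by (simp add: independent_walks_def)
  have Vm: "(\<lambda>\<omega>. V s \<omega> j) \<in> M \<rightarrow>\<^sub>M count_space UNIV"
    "(\<lambda>\<omega>. V t \<omega> j) \<in> M \<rightarrow>\<^sub>M count_space UNIV" if "j < N" for j
    using independent_walks_measurable[OF IW that] st by auto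
  define d where "d = t - s"
  have d: "0 \<le> d" "d \<le> T"
    using st by (auto simp: d_def)
  define B where "B j = {\<omega> \<in> space M. 2 \<le> \<bar>V t \<omega> j - V s \<omega> j\<bar>}" for j
  define C where "C j = {\<omega> \<in> space M. V t \<omega> j \<noteq> V s \<omega> j}" for j
  have BC: "B j \<in> sets M" "C j \<in> sets M" if "j < N" for j
  proof -
    define X Y where "X = (\<lambda>\<omega>. V s \<omega> j)" and "Y = (\<lambda>\<omega>. V t \<omega> j)"
    have [measurable]: "X \<in> M \<rightarrow>\<^sub>M count_space UNIV" "Y \<in> M \<rightarrow>\<^sub>M count_space UNIV"
      unfolding X_def Y_def by (rule Vm[OF that])+
    have D: "(\<lambda>\<omega>. Y \<omega> - X \<omega>) \<in> M \<rightarrow>\<^sub>M count_space UNIV"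
      by measurable
    have "B j = (\<lambda>\<omega>. Y \<omega> - X \<omega>) -` {z. 2 \<le> \<bar>z\<bar>} \<inter> space M" "C j = (\<lambda>\<omega>. Y \<omega> - X \<omega>) -` (- {0}) \<inter> space M"
      unfolding B_def C_def X_def Y_def by auto
    then show "B j \<in> sets M" "C j \<in> sets M"
      by (simp_all only: measurable_sets[OF D] sets_count_space Pow_UNIV UNIV_I)
  qed
  have PB: "prob (B j) \<le> 12 * d\<^sup>2 * exp (2 * T)" if "j < N" for j
    using small_increment_probabilities(2)[OF independent_walks_walk[OF IW that] st]
    by (simp add: B_def d_def)
  have PC: "prob (C j) \<le> d * (1 + 4 * T * exp (2 * T))" if "j < N" for j
  proof -
    have "prob (C j) \<le> d + 4 * d\<^sup>2 * exp (2 * T)"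
      using small_increment_probabilities(1)[OF independent_walks_walk[OF IW that] st]
      by (simp add: C_def d_def)
    also have "4 * d\<^sup>2 * exp (2 * T) \<le> 4 * (d * T) * exp (2 * T)"
      unfolding power2_eq_square using d by (intro mult_right_mono mult_left_mono) auto
    finally show ?thesis
      by (simp add: algebra_simps)
  qed
  let ?P = "PiM {0..} (\<lambda>_. count_space UNIV) :: (real \<Rightarrow> int) measure"
  define A where "A = {y \<in> space ?P. y t \<noteq> y s}"
  have A: "A \<in> sets ?P"
  proof -
    have [measurable]: "(\<lambda>y. y t) \<in> ?P \<rightarrow>\<^sub>M count_space UNIV" "(\<lambda>y. y s) \<in> ?P \<rightarrow>\<^sub>M count_space UNIV"
      using st by (auto intro!: measurable_component_singleton)
    show ?thesis
      unfolding A_def by measurable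
  qed
  have indep: "indep_vars (\<lambda>j. ?P) (\<lambda>j \<omega>. \<lambda>t\<in>{0..}. V t \<omega> j) {..<N}"
    using IW by (simp add: independent_walks_def)
  have pre: "(\<lambda>\<omega>. \<lambda>t\<in>{0..}. V t \<omega> j) -` A \<inter> space M = C j" for j
    using st by (auto simp: A_def C_def space_PiM)
  have PCC: "prob (C j \<inter> C k) \<le> (d * (1 + 4 * T * exp (2 * T)))\<^sup>2" if jk: "j < N" "k < N" "j \<noteq> k" for j k
  proof -
    have "prob (\<Inter>i\<in>{j, k}. (\<lambda>\<omega>. \<lambda>t\<in>{0..}. V t \<omega> i) -` A \<inter> space M) =
        (\<Prod>i\<in>{j, k}. prob ((\<lambda>\<omega>. \<lambda>t\<in>{0..}. V t \<omega> i) -` A \<inter> space M))"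
      by (rule indep_varsD[OF indep]) (use jk A in auto)
    then have "prob (C j \<inter> C k) = prob (C j) * prob (C k)"
      using jk unfolding pre by simp
    also have "\<dots> \<le> (d * (1 + 4 * T * exp (2 * T))) * (d * (1 + 4 * T * exp (2 * T)))"
      using PC jk d by (intro mult_mono) auto
    finally show ?thesis
      by (simp add: power2_eq_square)
  qed
  define I where "I = {(j, k). j < N \<and> k < N \<and> j \<noteq> k}"
  have I: "I \<subseteq> {..<N} \<times> {..<N}"
    by (auto simp: I_def)
  then have finI: "finite I"
    by (rule finite_subset) auto
  have cardI: "real (card I) \<le> (real N)\<^sup>2"
    using card_mono[OF _ I] by (simp add: power2_eq_square flip: of_nat_mult)
  have "{\<omega> \<in> space M. double_jump N (V s \<omega>) (V t \<omega>)} = (\<Union>j\<in>{..<N}. B j) \<union> (\<Union>(j, k)\<in>I. C j \<inter> C k)"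
    by (auto simp: double_jump_def B_def C_def I_def)
  also have "prob \<dots> \<le> prob (\<Union>j\<in>{..<N}. B j) + prob (\<Union>(j, k)\<in>I. C j \<inter> C k)"
    using BC finI by (intro measure_Un_le sets.finite_UN) (auto simp: I_def)
  also have "prob (\<Union>j\<in>{..<N}. B j) \<le> (\<Sum>j\<in>{..<N}. prob (B j))"
    using BC by (intro finite_measure_subadditive_finite) auto
  also have "\<dots> \<le> (\<Sum>j\<in>{..<N}. 12 * d\<^sup>2 * exp (2 * T))"
    using PB by (intro sum_mono) auto
  also have "prob (\<Union>(j, k)\<in>I. C j \<inter> C k) \<le> (\<Sum>p\<in>I. prob (case p of (j, k) \<Rightarrow> C j \<inter> C k))"
    using BC finI by (intro finite_measure_subadditive_finite) (auto simp: I_def)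
  also have "\<dots> \<le> (\<Sum>p\<in>I. (d * (1 + 4 * T * exp (2 * T)))\<^sup>2)"
    using PCC by (intro sum_mono) (auto simp: I_def)
  also have "\<dots> = real (card I) * (d * (1 + 4 * T * exp (2 * T)))\<^sup>2"
    by simp
  also have "\<dots> \<le> (real N)\<^sup>2 * (d * (1 + 4 * T * exp (2 * T)))\<^sup>2"
    using cardI by (intro mult_right_mono) auto
  finally show ?thesis
    unfolding double_jump_const_def d_def[symmetric] power_mult_distrib[of d] distrib_right
    by (simp add: mult_ac)
qed

text \<open>
  Trades the unbounded factor \<open>h\<close> against a constant \<open>l\<close>.  The fourth moment makes the remainder
  \<open>l ^ -3\<close>, small enough that with \<open>l\<close> of order \<open>d ^ (-1/2)\<close> both terms are of order \<open>d ^ (3/2)\<close> per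
  step of length \<open>d\<close>, so that their sum over about \<open>1 / d\<close> steps still tends to zero.
\<close>

lemma truncation_bound:
  fixes h l :: real
  assumes "0 < l"
  shows "\<bar>h\<bar> * of_bool E \<le> l * of_bool E + h ^ 4 / l ^ 3"
proof (cases "E \<and> l < \<bar>h\<bar>")
  case True
  have "\<bar>h\<bar> * l ^ 3 \<le> \<bar>h\<bar> * \<bar>h\<bar> ^ 3"
    using True assms by (intro mult_left_mono power_mono) auto
  also have "\<dots> = h ^ 4"
    by (simp add: numeral_eq_Suc abs_mult[symmetric])
  finally have "\<bar>h\<bar> \<le> h ^ 4 / l ^ 3"
    using assms by (simp add: field_simps)
  then show ?thesis
    using True assms by simp
next
  case False
  have "0 \<le> h ^ 4 / l ^ 3"
    using assms by simp
  moreover have "\<bar>h\<bar> * of_bool E \<le> l * of_bool E"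
    using False assms by (auto simp: not_less)
  ultimately show ?thesis
    by linarith
qed

text \<open>
  These are the functions of the unlabelled configuration \<open>unlabel N x\<close>.
\<close>

definition symmetric_fn :: "nat \<Rightarrow> ((nat \<Rightarrow> int) \<Rightarrow> real) \<Rightarrow> bool" where
  "symmetric_fn N f \<longleftrightarrow> (\<forall>x p. p permutes {..<N} \<longrightarrow> f (x \<circ> p) = f x) \<and>
     (\<forall>x y. (\<forall>j<N. x j = y j) \<longrightarrow> f x = f y)"

lemma weyl_chamber_cong: "(\<And>j. j < N \<Longrightarrow> x j = y j) \<Longrightarrow> x \<in> weyl_chamber N \<longleftrightarrow> y \<in> weyl_chamber N"
  by (auto simp: weyl_chamber_def)

lemma weyl_chamber_rvec_cong:
  "(\<And>j. j < N \<Longrightarrow> x j = y j) \<Longrightarrow> rvec x \<in> weyl_chamber N \<longleftrightarrow> rvec y \<in> weyl_chamber N"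
  by (rule weyl_chamber_cong) (simp add: rvec_def)

lemma h_weyl_cong: "(\<And>j. j < N \<Longrightarrow> x j = y j) \<Longrightarrow> h_weyl N x = h_weyl N y"
  unfolding h_weyl_def by (intro prod.cong) auto

lemma h_weyl_swap_colliding:
  assumes "\<exists>p. collision N x p"
  shows "h_weyl N (rvec (y \<circ> swap_colliding N x)) = - h_weyl N (rvec y)"
proof (cases N x rule: swap_colliding_cases)
  case (1 a b)
  then show ?thesis
    using h_weyl_transpose[of a N b "rvec y"] by (simp add: rvec_def o_def)
next
  case 2
  then show ?thesis
    using assms by blast
qed

section \<open>Cancellation of the exiting paths\<close>

text \<open>
  The exit event of the grid is decomposed according to the first grid time outside the chamber.  If two
  walkers coincide there, the reflection map leaves this event and the symmetric factors unchanged and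
  reverses the sign of \<open>h\<close>, so the contribution is zero.  Otherwise the last step was a double jump, and
  the contribution is bounded by its probability and the truncation bound.
\<close>

proposition skeleton_exit_bound:
  fixes f :: "nat \<Rightarrow> (nat \<Rightarrow> int) \<Rightarrow> real"
  assumes IW: "independent_walks N u M V" and N: "1 \<le> N" and u: "rvec u \<in> weyl_chamber N"
    and s: "s 0 = 0" "\<And>i. i < m \<Longrightarrow> s i \<le> s (Suc i)" "s m = T"
    and mesh: "\<And>i. i < m \<Longrightarrow> s (Suc i) - s i \<le> d"
    and f1: "\<And>i x. \<bar>f i x\<bar> \<le> 1" and fsym: "\<And>i. symmetric_fn N (f i)"
    and l: "0 < l"
  shows "\<bar>\<integral>\<omega>. (\<Prod>i\<le>m. f i (V (s i) \<omega>)) * h_weyl N (rvec (V T \<omega>)) *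
       of_bool (\<exists>i\<le>m. rvec (V (s i) \<omega>) \<notin> weyl_chamber N) \<partial>M\<bar>
     \<le> real m * (l * (double_jump_const N T * d\<^sup>2) + (\<integral>\<omega>. h_weyl N (rvec (V T \<omega>)) ^ 4 \<partial>M) / l ^ 3)"
proof -
  interpret prob_space M
    using IW by (simp add: independent_walks_def)
  have smono: "s i \<le> s j" if "i \<le> j" "j \<le> m" for i j
    using time_grid_mono[of m s i j, OF s(2)] that by simp
  have T: "0 \<le> T"
    using smono[of 0 m] s by simp
  let ?h = "\<lambda>x. h_weyl N (rvec x)"
  let ?W = "\<lambda>x. rvec x \<in> weyl_chamber N"
  define S where "S = skeleton N s m V"
  have S_meas: "S \<in> M \<rightarrow>\<^sub>M count_space (skeletons N m)"
    unfolding S_def using smono[of 0] s by (intro skeleton_measurable[OF IW]) auto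
  have meas[measurable]: "(\<lambda>\<omega>. \<phi> (S \<omega>) :: real) \<in> borel_measurable M" for \<phi>
    by (rule measurable_compose[OF S_meas]) simp
  have S_h: "?h (S \<omega> m) = ?h (V T \<omega>)" for \<omega>
    by (rule h_weyl_cong) (simp add: S_def skeleton_def rvec_def s)
  have S_W: "?W (S \<omega> i) \<longleftrightarrow> ?W (V (s i) \<omega>)" if "i \<le> m" for i \<omega>
    using that by (intro weyl_chamber_cong) (simp add: S_def skeleton_def rvec_def)
  have S_f: "f i (S \<omega> i) = f i (V (s i) \<omega>)" if "i \<le> m" for i \<omega>
    using fsym[of i] that by (auto simp: symmetric_fn_def S_def skeleton_def)
  define \<Psi> where "\<Psi> v = (\<Prod>i\<le>m. f i (v i)) * ?h (v m)" for v :: "nat \<Rightarrow> nat \<Rightarrow> int"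
  define E where "E i v \<longleftrightarrow> (\<forall>i'<i. ?W (v i')) \<and> \<not> ?W (v i)" for i and v :: "nat \<Rightarrow> nat \<Rightarrow> int"
  have \<Psi>_bound: "\<bar>\<Psi> v\<bar> \<le> \<bar>?h (v m)\<bar>" for v
  proof -
    have "\<bar>\<Prod>i\<le>m. f i (v i)\<bar> \<le> 1"
      unfolding abs_prod by (intro prod_le_1) (auto simp: f1)
    then show ?thesis
      unfolding \<Psi>_def abs_mult by (rule mult_left_le_one_le[OF abs_ge_zero abs_ge_zero])
  qed
  have h_int: "integrable M (\<lambda>\<omega>. ?h (V T \<omega>))"
    using integrable_h_weyl_power[OF IW T, of 1] by simp
  have int: "integrable M (\<lambda>\<omega>. \<Psi> (S \<omega>) * of_bool (Q (S \<omega>)))" for Q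
  proof (rule Bochner_Integration.integrable_bound[OF h_int])
    show "AE \<omega> in M. norm (\<Psi> (S \<omega>) * of_bool (Q (S \<omega>))) \<le> norm (?h (V T \<omega>))"
      using \<Psi>_bound[of "S _"] by (intro AE_I2) (simp add: S_h of_bool_def)
  qed (rule meas)
  have exit_split: "of_bool (\<exists>i\<le>m. \<not> ?W (v i)) = (\<Sum>i\<le>m. of_bool (E i v) :: real)" for v
  proof (cases "\<exists>i\<le>m. \<not> ?W (v i)")
    case True
    define k where "k = (LEAST i. \<not> ?W (v i))"
    obtain i where i: "i \<le> m" "\<not> ?W (v i)"
      using True by blast
    have k: "k \<le> m" "\<not> ?W (v k)"
      unfolding k_def using i LeastI[of "\<lambda>i. \<not> ?W (v i)" i] Least_le[of "\<lambda>i. \<not> ?W (v i)" i] by auto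
    have "E i v \<longleftrightarrow> i = k" for i
    proof
      assume "E i v"
      then show "i = k"
        using k(2) not_less_Least[of i "\<lambda>i. \<not> ?W (v i)"] unfolding E_def k_def[symmetric]
        by (metis linorder_neqE_nat)
    next
      assume "i = k"
      then show "E i v"
        using k(2) not_less_Least[of _ "\<lambda>i. \<not> ?W (v i)"] unfolding E_def k_def[symmetric] by blast
    qed
    then show ?thesis
      using True k(1) by (simp add: of_bool_def)
  next
    case False
    then show ?thesis
      by (auto simp: E_def)
  qed
  have collide: "(\<integral>\<omega>. \<Psi> (S \<omega>) * of_bool (E i (S \<omega>) \<and> (\<exists>p. collision N (S \<omega> i) p)) \<partial>M) = 0"
    if i: "i \<le> m" for i
  proof -
    \<comment> \<open>the reflection map at time \<open>i\<close> turns this integrand into its negative\<close>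
    let ?\<phi> = "\<lambda>v. \<Psi> v * of_bool (E i v \<and> (\<exists>p. collision N (v i) p))"
    have "?\<phi> (swap_after N m i v) = - ?\<phi> v" for v
    proof (cases "\<exists>p. collision N (v i) p")
      case True
      have "f i' (swap_after N m i v i') = f i' (v i')" for i'
        using fsym[of i'] swap_colliding_permutes[of N "v i"]
        by (auto simp: swap_after_def symmetric_fn_def)
      moreover have "?h (swap_after N m i v m) = - ?h (v m)"
        using h_weyl_swap_colliding[OF True] i by (simp add: swap_after_def)
      ultimately have "\<Psi> (swap_after N m i v) = - \<Psi> v"
        by (simp add: \<Psi>_def)
      moreover have "E i (swap_after N m i v) = E i v"
        by (simp add: E_def swap_after_before)
      ultimately show ?thesis
        by (simp add: swap_after_before)
    qed (simp add: swap_after_before)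
    then show ?thesis
      using skeleton_swap_invariance[OF IW N s(1,2) i, of ?\<phi>] unfolding S_def by simp
  qed
  define R where "R = l * (double_jump_const N T * d\<^sup>2) + (\<integral>\<omega>. ?h (V T \<omega>) ^ 4 \<partial>M) / l ^ 3"
  have no_collide: "\<bar>\<integral>\<omega>. \<Psi> (S \<omega>) * of_bool (E (Suc i) (S \<omega>) \<and> \<not> (\<exists>p. collision N (S \<omega> (Suc i)) p)) \<partial>M\<bar> \<le> R"
    if i: "i < m" for i
  proof -
    let ?J = "\<lambda>\<omega>. double_jump N (S \<omega> i) (S \<omega> (Suc i))"
    have J: "?J \<omega> \<longleftrightarrow> double_jump N (V (s i) \<omega>) (V (s (Suc i)) \<omega>)" for \<omega>
      using i by (auto simp: double_jump_def S_def skeleton_def)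
    have i4: "integrable M (\<lambda>\<omega>. ?h (V T \<omega>) ^ 4)"
      by (rule integrable_h_weyl_power[OF IW T])
    have PJ: "(\<integral>\<omega>. of_bool (?J \<omega>) \<partial>M) \<le> double_jump_const N T * d\<^sup>2"
    proof -
      have "(\<integral>\<omega>. of_bool (?J \<omega>) \<partial>M) = (\<integral>\<omega>. indicator {\<omega> \<in> space M. ?J \<omega>} \<omega> \<partial>M)"
        by (intro Bochner_Integration.integral_cong) (auto simp: indicator_def)
      also have "\<dots> = prob {\<omega> \<in> space M. ?J \<omega>}"
        by (simp add: Int_absorb2 subset_eq)
      also have "\<dots> \<le> double_jump_const N T * (s (Suc i) - s i)\<^sup>2"
        unfolding J using i smono[of 0 i] smono[of "Suc i" m] s by (intro double_jump_probability[OF IW]) auto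
      also have "\<dots> \<le> double_jump_const N T * d\<^sup>2"
        using mesh[OF i] s(2)[OF i] T by (intro mult_left_mono power_mono) (auto simp: double_jump_const_def)
      finally show ?thesis .
    qed
    have iJ: "integrable M (\<lambda>\<omega>. of_bool (?J \<omega>) :: real)"
      by (rule integrable_const_bound[where B = 1]) (use meas[of "\<lambda>v. of_bool (double_jump N (v i) (v (Suc i)))"] in auto)
    have "\<bar>\<integral>\<omega>. \<Psi> (S \<omega>) * of_bool (E (Suc i) (S \<omega>) \<and> \<not> (\<exists>p. collision N (S \<omega> (Suc i)) p)) \<partial>M\<bar>
        \<le> (\<integral>\<omega>. \<bar>\<Psi> (S \<omega>) * of_bool (E (Suc i) (S \<omega>) \<and> \<not> (\<exists>p. collision N (S \<omega> (Suc i)) p))\<bar> \<partial>M)"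
      by (rule integral_abs_bound)
    also have "\<dots> \<le> (\<integral>\<omega>. l * of_bool (?J \<omega>) + ?h (V T \<omega>) ^ 4 / l ^ 3 \<partial>M)"
    proof (rule integral_mono)
      show "integrable M (\<lambda>\<omega>. \<bar>\<Psi> (S \<omega>) * of_bool (E (Suc i) (S \<omega>) \<and> \<not> (\<exists>p. collision N (S \<omega> (Suc i)) p))\<bar>)"
        by (rule integrable_abs[OF int[of "\<lambda>v. E (Suc i) v \<and> \<not> (\<exists>p. collision N (v (Suc i)) p)"]])
      fix \<omega>
      have "\<bar>\<Psi> (S \<omega>) * of_bool (E (Suc i) (S \<omega>) \<and> \<not> (\<exists>p. collision N (S \<omega> (Suc i)) p))\<bar>
          \<le> \<bar>?h (V T \<omega>)\<bar> * of_bool (?J \<omega>)"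
        using \<Psi>_bound[of "S \<omega>"] exit_without_collision_double_jump[of "S \<omega> i" N "S \<omega> (Suc i)"]
        by (auto simp: S_h E_def of_bool_def)
      also have "\<dots> \<le> l * of_bool (?J \<omega>) + ?h (V T \<omega>) ^ 4 / l ^ 3"
        by (rule truncation_bound[OF l])
      finally show "\<bar>\<Psi> (S \<omega>) * of_bool (E (Suc i) (S \<omega>) \<and> \<not> (\<exists>p. collision N (S \<omega> (Suc i)) p))\<bar> \<le> \<dots>" .
    qed (use i4 iJ in auto)
    also have "\<dots> = l * (\<integral>\<omega>. of_bool (?J \<omega>) \<partial>M) + (\<integral>\<omega>. ?h (V T \<omega>) ^ 4 \<partial>M) / l ^ 3"
      using i4 iJ by simp
    also have "\<dots> \<le> R"
      unfolding R_def using PJ l by (intro add_right_mono mult_left_mono) auto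
    finally show ?thesis .
  qed
  have term_split: "(\<integral>\<omega>. \<Psi> (S \<omega>) * of_bool (E i (S \<omega>)) \<partial>M) =
      (\<integral>\<omega>. \<Psi> (S \<omega>) * of_bool (E i (S \<omega>) \<and> \<not> (\<exists>p. collision N (S \<omega> i) p)) \<partial>M)" if "i \<le> m" for i
  proof -
    have "(\<integral>\<omega>. \<Psi> (S \<omega>) * of_bool (E i (S \<omega>)) \<partial>M) =
        (\<integral>\<omega>. \<Psi> (S \<omega>) * of_bool (E i (S \<omega>) \<and> (\<exists>p. collision N (S \<omega> i) p)) +
           \<Psi> (S \<omega>) * of_bool (E i (S \<omega>) \<and> \<not> (\<exists>p. collision N (S \<omega> i) p)) \<partial>M)"
      by (intro Bochner_Integration.integral_cong) (auto simp: of_bool_def)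
    also have "\<dots> = (\<integral>\<omega>. \<Psi> (S \<omega>) * of_bool (E i (S \<omega>) \<and> (\<exists>p. collision N (S \<omega> i) p)) \<partial>M) +
        (\<integral>\<omega>. \<Psi> (S \<omega>) * of_bool (E i (S \<omega>) \<and> \<not> (\<exists>p. collision N (S \<omega> i) p)) \<partial>M)"
      using int[of "\<lambda>v. E i v \<and> (\<exists>p. collision N (v i) p)"] int[of "\<lambda>v. E i v \<and> \<not> (\<exists>p. collision N (v i) p)"]
      by (rule Bochner_Integration.integral_add)
    finally show ?thesis
      using collide[OF that] by simp
  qed
  have term0: "(\<integral>\<omega>. \<Psi> (S \<omega>) * of_bool (E 0 (S \<omega>)) \<partial>M) = 0"
  proof -
    have "AE \<omega> in M. \<forall>j\<in>{..<N}. V 0 \<omega> j = u j"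
      using independent_walks_walk[OF IW]
      by (intro AE_finite_allI) (auto simp: simple_random_walk_def)
    then have "AE \<omega> in M. \<Psi> (S \<omega>) * of_bool (E 0 (S \<omega>)) = 0"
    proof eventually_elim
      fix \<omega> assume "\<forall>j\<in>{..<N}. V 0 \<omega> j = u j"
      then have "?W (V 0 \<omega>) \<longleftrightarrow> ?W u"
        by (intro weyl_chamber_cong) (auto simp: rvec_def)
      then show "\<Psi> (S \<omega>) * of_bool (E 0 (S \<omega>)) = 0"
        using u S_W[of 0 \<omega>] s by (simp add: E_def)
    qed
    then show ?thesis
      by (rule integral_eq_zero_AE)
  qed
  have "(\<integral>\<omega>. (\<Prod>i\<le>m. f i (V (s i) \<omega>)) * ?h (V T \<omega>) * of_bool (\<exists>i\<le>m. \<not> ?W (V (s i) \<omega>)) \<partial>M) =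
      (\<integral>\<omega>. (\<Sum>i\<le>m. \<Psi> (S \<omega>) * of_bool (E i (S \<omega>))) \<partial>M)"
  proof (rule Bochner_Integration.integral_cong)
    fix \<omega>
    have "(\<exists>i\<le>m. \<not> ?W (V (s i) \<omega>)) \<longleftrightarrow> (\<exists>i\<le>m. \<not> ?W (S \<omega> i))"
      using S_W by auto
    moreover have "(\<Prod>i\<le>m. f i (V (s i) \<omega>)) * ?h (V T \<omega>) = \<Psi> (S \<omega>)"
      by (simp add: \<Psi>_def S_f S_h)
    ultimately show "(\<Prod>i\<le>m. f i (V (s i) \<omega>)) * ?h (V T \<omega>) * of_bool (\<exists>i\<le>m. \<not> ?W (V (s i) \<omega>)) =
        (\<Sum>i\<le>m. \<Psi> (S \<omega>) * of_bool (E i (S \<omega>)))"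
      by (simp only: exit_split[of "S \<omega>"] sum_distrib_left)
  qed simp
  also have "\<dots> = (\<Sum>i\<le>m. \<integral>\<omega>. \<Psi> (S \<omega>) * of_bool (E i (S \<omega>)) \<partial>M)"
    by (rule Bochner_Integration.integral_sum) (rule int)
  also have "\<dots> = (\<Sum>i<m. \<integral>\<omega>. \<Psi> (S \<omega>) * of_bool (E (Suc i) (S \<omega>)) \<partial>M)"
    by (simp add: lessThan_Suc_atMost[symmetric] sum.lessThan_Suc_shift term0 del: sum.lessThan_Suc)
  finally have "\<bar>\<integral>\<omega>. (\<Prod>i\<le>m. f i (V (s i) \<omega>)) * ?h (V T \<omega>) * of_bool (\<exists>i\<le>m. \<not> ?W (V (s i) \<omega>)) \<partial>M\<bar> =
      \<bar>\<Sum>i<m. \<integral>\<omega>. \<Psi> (S \<omega>) * of_bool (E (Suc i) (S \<omega>)) \<partial>M\<bar>"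
    by simp
  also have "\<dots> \<le> (\<Sum>i<m. \<bar>\<integral>\<omega>. \<Psi> (S \<omega>) * of_bool (E (Suc i) (S \<omega>)) \<partial>M\<bar>)"
    by (rule sum_abs)
  also have "\<dots> \<le> (\<Sum>i<m. R)"
    by (intro sum_mono) (use term_split no_collide in auto)
  finally show ?thesis
    by (simp add: R_def)
qed

text \<open>
  Merging a finite set \<open>J\<close> of prescribed times with the uniform grid of \<open>n\<close> steps keeps the mesh at
  most \<open>T / n\<close>: the next uniform point after a grid time is itself a grid time.
\<close>

lemma time_grid_exists:
  fixes T :: real
  assumes T: "0 \<le> T" and J: "finite J" "J \<subseteq> {0..T}" and n: "0 < n"
  obtains s m where "s 0 = 0" "s m = T" "strict_mono_on {..m} s" "\<And>i. i < m \<Longrightarrow> s (Suc i) - s i \<le> T / real n"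
    "s ` {..m} = J \<union> (\<lambda>i. T * real i / real n) ` {..n}" "m \<le> card J + n"
proof -
  define D where "D = J \<union> (\<lambda>i. T * real i / real n) ` {..n}"
  have D: "finite D" "D \<subseteq> {0..T}"
    using J T n by (auto simp: D_def field_simps mult_left_mono)
  have ends: "0 \<in> D" "T \<in> D"
    using n by (auto simp: D_def intro: image_eqI[of _ _ 0] image_eqI[of _ _ n])
  define xs where "xs = sorted_list_of_set D"
  define m where "m = card D - 1"
  define s where "s i = xs ! i" for i
  have "0 < card D"
    using D(1) ends(1) card_gt_0_iff by blast
  then have len: "length xs = Suc m"
    by (simp add: xs_def m_def)
  have less: "s i < s j" if "i < j" "j \<le> m" for i j
    using sorted_wrt_nth_less[OF strict_sorted_list_of_set[of D], of i j] that len by (simp add: s_def xs_def)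
  then have le: "s i \<le> s j" if "i \<le> j" "j \<le> m" for i j
    using that by (cases "i = j") (auto intro: less_imp_le)
  have img: "s ` {..m} = D"
  proof -
    have "s ` {..m} = set xs"
      using len by (auto simp: s_def set_conv_nth less_Suc_eq_le)
    then show ?thesis
      using D(1) by (simp add: xs_def)
  qed
  have mem: "s i \<in> D" if "i \<le> m" for i
    using img that by auto
  obtain i\<^sub>0 i\<^sub>1 where i: "i\<^sub>0 \<le> m" "s i\<^sub>0 = 0" "i\<^sub>1 \<le> m" "s i\<^sub>1 = T"
    using ends img by (metis atMost_iff imageE)
  have s0: "s 0 = 0"
    using le[of 0 i\<^sub>0] i mem[of 0] D(2) by fastforce
  have sm: "s m = T"
    using le[of i\<^sub>1 m] i mem[of m] D(2) by fastforce
  have gap: "s (Suc i) - s i \<le> T / real n" if i: "i < m" for i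
  proof -
    have lt: "s i < s (Suc i)" "s (Suc i) \<le> T" "0 \<le> s i"
      using less[of i "Suc i"] le[of "Suc i" m] le[of 0 i] sm s0 i by auto
    then have T0: "0 < T"
      by linarith
    \<comment> \<open>\<open>T * q / n\<close> is the last uniform grid point up to \<open>s i\<close>, so \<open>T * (q + 1) / n\<close> lies beyond \<open>s i\<close>\<close>
    define q where "q = nat \<lfloor>s i * real n / T\<rfloor>"
    have q: "real q \<le> s i * real n / T" "s i * real n / T < real q + 1"
      using lt T0 n unfolding q_def by (simp_all add: of_nat_floor)
    have "s i * real n / T < real n"
      using lt T0 n by (simp add: field_simps)
    then have "Suc q \<le> n"
      using q(1) by linarith
    then have "T * real (Suc q) / real n \<in> D"
      unfolding D_def by (intro UnI2 image_eqI[OF refl]) simp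
    then obtain k where k: "k \<le> m" "s k = T * real (Suc q) / real n"
      using img by (metis atMost_iff imageE)
    have "s i < s k"
      using q(2) T0 n by (simp add: k(2) field_simps)
    then have "\<not> k \<le> i"
      using le[of k i] i by auto
    then have "s (Suc i) \<le> s k"
      using le[of "Suc i" k] k(1) by auto
    also have "\<dots> \<le> s i + T / real n"
      using q(1) T0 n by (simp add: k(2) field_simps)
    finally show ?thesis
      by simp
  qed
  have "card D \<le> card J + card ((\<lambda>i. T * real i / real n) ` {..n})"
    unfolding D_def by (rule card_Un_le)
  also have "card ((\<lambda>i. T * real i / real n) ` {..n}) \<le> Suc n"
    using card_image_le[of "{..n}" "\<lambda>i. T * real i / real n"] by simp
  finally have "m \<le> card J + n"
    by (simp add: m_def)
  then show ?thesis
    using that[of s m] s0 sm gap img less by (auto simp: D_def strict_mono_on_def)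
qed

text \<open>
  A function of the first \<open>N\<close> coordinates at time \<open>r\<close> factors through the skeleton of a one-point grid,
  which takes values in a countable discrete space.
\<close>

lemma walks_local_measurable:
  assumes IW: "independent_walks N u M V" and r: "0 \<le> r"
    and local: "\<And>x y. (\<And>j. j < N \<Longrightarrow> x j = y j) \<Longrightarrow> \<phi> x = \<phi> y" and space: "\<And>x. \<phi> x \<in> space L"
  shows "(\<lambda>\<omega>. \<phi> (V r \<omega>)) \<in> M \<rightarrow>\<^sub>M L"
proof -
  have "skeleton N (\<lambda>_. r) 0 V \<in> M \<rightarrow>\<^sub>M count_space (skeletons N 0)"
    by (rule skeleton_measurable[OF IW r])
  moreover have "(\<lambda>v. \<phi> (v 0)) \<in> count_space (skeletons N 0) \<rightarrow>\<^sub>M L"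
    using space by auto
  ultimately have "(\<lambda>\<omega>. \<phi> (skeleton N (\<lambda>_. r) 0 V \<omega> 0)) \<in> M \<rightarrow>\<^sub>M L"
    by (rule measurable_compose)
  also have "(\<lambda>\<omega>. \<phi> (skeleton N (\<lambda>_. r) 0 V \<omega> 0)) = (\<lambda>\<omega>. \<phi> (V r \<omega>))"
    by (intro ext local) (simp add: skeleton_def)
  finally show ?thesis .
qed

text \<open>
  For integer-valued paths, right continuity means being constant on a right neighbourhood.
\<close>

lemma walks_right_constant:
  assumes IW: "independent_walks N u M V" and \<omega>: "\<omega> \<in> space M" and r: "0 \<le> r"
  obtains b where "r < b" "\<And>y j. r < y \<Longrightarrow> y < b \<Longrightarrow> j < N \<Longrightarrow> V y \<omega> j = V r \<omega> j"
proof -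
  have "\<forall>\<^sub>F y in at_right r. V y \<omega> j = V r \<omega> j" if "j < N" for j
  proof -
    have "cadlag (\<lambda>t. V t \<omega> j)"
      using independent_walks_walk[OF IW that] \<omega> by (auto simp: simple_random_walk_def)
    then have "((\<lambda>t. V t \<omega> j) \<longlongrightarrow> V r \<omega> j) (at_right r)"
      using r by (auto simp: cadlag_def continuous_within)
    from topological_tendstoD[OF this Topological_Spaces.open_discrete, of "{V r \<omega> j}"] show ?thesis
      by simp
  qed
  then have "\<forall>\<^sub>F y in at_right r. \<forall>j\<in>{..<N}. V y \<omega> j = V r \<omega> j"
    by (intro eventually_ball_finite) auto
  then show ?thesis
    using that unfolding eventually_at_right_field by auto
qed

text \<open>
  The event \<open>\<tau> \<le> T\<close>; by right continuity the infimum that defines \<open>\<tau>\<close> is attained, see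
  \<open>less_exit_time_iff\<close>.
\<close>

definition exits_by :: "nat \<Rightarrow> (real \<Rightarrow> 'a \<Rightarrow> nat \<Rightarrow> int) \<Rightarrow> real \<Rightarrow> 'a \<Rightarrow> bool" where
  "exits_by N V T \<omega> \<longleftrightarrow> (\<exists>r\<in>{0..T}. rvec (V r \<omega>) \<notin> weyl_chamber N)"

lemma less_exit_time_iff:
  assumes IW: "independent_walks N u M V" and \<omega>: "\<omega> \<in> space M" and T: "0 \<le> T"
  shows "ereal T < exit_time N V \<omega> \<longleftrightarrow> \<not> exits_by N V T \<omega>"
proof
  assume less: "ereal T < exit_time N V \<omega>"
  show "\<not> exits_by N V T \<omega>"
  proof
    assume "exits_by N V T \<omega>"
    then obtain r where r: "0 \<le> r" "r \<le> T" "rvec (V r \<omega>) \<notin> weyl_chamber N"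
      by (auto simp: exits_by_def)
    then have "exit_time N V \<omega> \<le> ereal r"
      unfolding exit_time_def by (intro Inf_lower) auto
    also have "\<dots> \<le> ereal T"
      using r by simp
    finally show False
      using less by simp
  qed
next
  assume no: "\<not> exits_by N V T \<omega>"
  obtain b where b: "T < b" "\<And>y j. T < y \<Longrightarrow> y < b \<Longrightarrow> j < N \<Longrightarrow> V y \<omega> j = V T \<omega> j"
    using walks_right_constant[OF IW \<omega> T] by blast
  have "ereal b \<le> exit_time N V \<omega>"
    unfolding exit_time_def
  proof (rule Inf_greatest, clarify)
    fix t assume t: "0 \<le> t" "rvec (V t \<omega>) \<notin> weyl_chamber N"
    have "b \<le> t"
    proof (rule ccontr)
      assume "\<not> b \<le> t"
      moreover have "T < t"
        using no t by (auto simp: exits_by_def)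
      ultimately have "rvec (V t \<omega>) \<in> weyl_chamber N \<longleftrightarrow> rvec (V T \<omega>) \<in> weyl_chamber N"
        using b(2)[of t] by (intro weyl_chamber_cong) (auto simp: rvec_def)
      then show False
        using t no T by (auto simp: exits_by_def)
    qed
    then show "ereal b \<le> ereal t"
      by simp
  qed
  then show "ereal T < exit_time N V \<omega>"
    using b(1) by (meson ereal_less(2) less_ereal.simps(1) order_less_le_trans)
qed

text \<open>
  An exit before time \<open>T\<close> lasts for a short time interval by right continuity, and every sufficiently fine
  grid has a point in it; an exit at time \<open>T\<close> is seen because \<open>T\<close> is in every grid.  The grids have
  \<open>(k + 1)\<^sup>2\<close> steps so that the truncation level, of the order of the square root of this number, is
  the integer \<open>k + 1\<close>.
\<close>

lemma grid_detects_exit: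
  assumes IW: "independent_walks N u M V" and \<omega>: "\<omega> \<in> space M" and T: "0 \<le> T"
    and D: "\<And>k. (\<lambda>i. T * real i / real (Suc k ^ 2)) ` {..Suc k ^ 2} \<subseteq> D k" "\<And>k. D k \<subseteq> {0..T}"
  shows "(\<lambda>k. of_bool (\<exists>r\<in>D k. rvec (V r \<omega>) \<notin> weyl_chamber N) :: real) \<longlonglongrightarrow> of_bool (exits_by N V T \<omega>)"
proof (rule tendsto_eventually)
  show "\<forall>\<^sub>F k in sequentially. (of_bool (\<exists>r\<in>D k. rvec (V r \<omega>) \<notin> weyl_chamber N) :: real) = of_bool (exits_by N V T \<omega>)"
  proof (cases "exits_by N V T \<omega>")
    case False
    then have "\<not> (\<exists>r\<in>D k. rvec (V r \<omega>) \<notin> weyl_chamber N)" for k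
      using D(2)[of k] by (auto simp: exits_by_def)
    then show ?thesis
      using False by simp
  next
    case True
    then obtain r where r: "0 \<le> r" "r \<le> T" "rvec (V r \<omega>) \<notin> weyl_chamber N"
      by (auto simp: exits_by_def)
    show ?thesis
    proof (cases "r = T")
      case True
      have "T \<in> D k" for k
        using D(1)[of k] by (rule subsetD) (auto intro!: image_eqI[of _ _ "Suc k ^ 2"])
      then have "\<exists>r\<in>D k. rvec (V r \<omega>) \<notin> weyl_chamber N" for k
        using r True by blast
      then show ?thesis
        using \<open>exits_by N V T \<omega>\<close> by simp
    next
      case False
      obtain b where b: "r < b" "\<And>y j. r < y \<Longrightarrow> y < b \<Longrightarrow> j < N \<Longrightarrow> V y \<omega> j = V r \<omega> j"
        using walks_right_constant[OF IW \<omega> r(1)] by blast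
      define e where "e = min (b - r) (T - r)"
      have e: "0 < e" "0 < T"
        using b r False by (auto simp: e_def)
      obtain K where K: "T / e < real K"
        using reals_Archimedean2 by blast
      have "\<exists>r\<in>D k. rvec (V r \<omega>) \<notin> weyl_chamber N" if k: "K \<le> k" for k
      proof -
        define n where "n = Suc k ^ 2"
        have n: "0 < n" "real K \<le> real n"
        proof -
          have "Suc k * 1 \<le> Suc k * Suc k"
            by (intro mult_left_mono) auto
          then have "K \<le> n"
            using k by (simp add: n_def power2_eq_square)
          then show "real K \<le> real n"
            by (simp only: of_nat_le_iff)
        qed (simp add: n_def)
        \<comment> \<open>the first uniform grid point after \<open>r\<close> falls into the interval of length \<open>e\<close> after \<open>r\<close>\<close>
        define q where "q = nat \<lfloor>r * real n / T\<rfloor>"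
        have q: "real q \<le> r * real n / T" "r * real n / T < real q + 1"
          using r e n unfolding q_def by (simp_all add: of_nat_floor)
        define y where "y = T * real (Suc q) / real n"
        have ry: "r < y"
          using q(2) e n by (simp add: y_def field_simps)
        have "y \<le> r + T / real n"
          using q(1) e n by (simp add: y_def field_simps)
        also have "T / real n < e"
        proof -
          have "T < e * real K"
            using K e by (simp add: field_simps)
          also have "\<dots> \<le> e * real n"
            using n e by (intro mult_left_mono) auto
          finally show ?thesis
            using n by (simp add: field_simps)
        qed
        finally have ye: "y < r + e"
          by simp
        then have "y < T"
          by (simp add: e_def)
        then have "T * real (Suc q) < T * real n"
          using n by (simp add: y_def field_simps)
        then have "Suc q \<le> n"
          using e by simp
        then have "y \<in> D k"
          using D(1)[of k] unfolding y_def n_def by blast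
        moreover have "rvec (V y \<omega>) \<in> weyl_chamber N \<longleftrightarrow> rvec (V r \<omega>) \<in> weyl_chamber N"
          using b(2)[of y] ry ye by (intro weyl_chamber_cong) (auto simp: rvec_def e_def)
        ultimately show ?thesis
          using r(3) by blast
      qed
      then show ?thesis
        using True by (auto simp: eventually_sequentially)
    qed
  qed
qed

lemma exits_by_measurable:
  assumes IW: "independent_walks N u M V" and T: "0 \<le> T"
  shows "(\<lambda>\<omega>. of_bool (exits_by N V T \<omega>) :: real) \<in> borel_measurable M"
proof -
  define D where "D k = (\<lambda>i. T * real i / real (Suc k ^ 2)) ` {..Suc k ^ 2}" for k
  have D: "D k \<subseteq> {0..T}" for k
    using T by (auto simp: D_def field_simps mult_left_mono simp del: of_nat_power)
  show ?thesis
  proof (rule borel_measurable_LIMSEQ_real)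
    show "(\<lambda>k. of_bool (\<exists>r\<in>D k. rvec (V r \<omega>) \<notin> weyl_chamber N) :: real) \<longlonglongrightarrow> of_bool (exits_by N V T \<omega>)"
      if "\<omega> \<in> space M" for \<omega>
      by (rule grid_detects_exit[OF IW that T _ D]) (simp add: D_def)
    fix k
    have "(\<lambda>\<omega>. rvec (V r \<omega>) \<notin> weyl_chamber N) \<in> M \<rightarrow>\<^sub>M count_space UNIV" if "r \<in> D k" for r
      using D[of k] that
      by (intro walks_local_measurable[OF IW, of r "\<lambda>x. rvec x \<notin> weyl_chamber N"]
            arg_cong[where f = Not] weyl_chamber_rvec_cong) auto
    moreover have "finite (D k)"
      by (simp add: D_def)
    ultimately have "(\<lambda>\<omega>. \<exists>r\<in>D k. rvec (V r \<omega>) \<notin> weyl_chamber N) \<in> M \<rightarrow>\<^sub>M count_space UNIV"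
      by (intro pred_intros_finite) auto
    then show "(\<lambda>\<omega>. of_bool (\<exists>r\<in>D k. rvec (V r \<omega>) \<notin> weyl_chamber N) :: real) \<in> borel_measurable M"
      by (rule measurable_compose) simp
  qed
qed

text \<open>
  The integrals over the exit events of the grids converge to the one over \<open>\<tau> \<le> T\<close> by dominated
  convergence.  With \<open>n = (k + 1)\<^sup>2\<close> uniform steps and \<open>l = k + 1\<close>, the bound of \<open>skeleton_exit_bound\<close> is a
  constant times \<open>n / l\<^sup>3\<close>, which tends to zero.
\<close>

proposition exit_part_cancels:
  fixes g :: "real \<Rightarrow> (nat \<Rightarrow> int) \<Rightarrow> real"
  assumes IW: "independent_walks N u M V" and N: "1 \<le> N" and u: "rvec u \<in> weyl_chamber N"
    and T: "0 \<le> T" and J: "finite J" "J \<subseteq> {0..T}"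
    and g1: "\<And>r x. \<bar>g r x\<bar> \<le> 1" and gsym: "\<And>r. symmetric_fn N (g r)"
  shows "(\<integral>\<omega>. (\<Prod>r\<in>J. g r (V r \<omega>)) * h_weyl N (rvec (V T \<omega>)) * of_bool (exits_by N V T \<omega>) \<partial>M) = 0"
proof -
  let ?h = "\<lambda>x. h_weyl N (rvec x)"
  let ?W = "\<lambda>x. rvec x \<in> weyl_chamber N"
  let ?G = "\<lambda>\<omega>. (\<Prod>r\<in>J. g r (V r \<omega>)) * ?h (V T \<omega>)"
  have g_meas: "(\<lambda>\<omega>. g r (V r \<omega>)) \<in> borel_measurable M" if "r \<in> J" for r
    using that J(2) gsym[of r]
    by (intro walks_local_measurable[OF IW]) (auto simp: symmetric_fn_def)
  have h_meas: "(\<lambda>\<omega>. ?h (V T \<omega>)) \<in> borel_measurable M"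
    by (rule h_weyl_measurable[OF IW T])
  have G_meas: "?G \<in> borel_measurable M"
    using g_meas h_meas by (intro borel_measurable_times borel_measurable_prod) auto
  have G_bound: "\<bar>?G \<omega>\<bar> \<le> \<bar>?h (V T \<omega>)\<bar>" for \<omega>
  proof -
    have "\<bar>\<Prod>r\<in>J. g r (V r \<omega>)\<bar> \<le> 1"
      unfolding abs_prod by (intro prod_le_1) (auto simp: g1)
    then show ?thesis
      unfolding abs_mult by (rule mult_left_le_one_le[OF abs_ge_zero abs_ge_zero])
  qed
  have "\<exists>s m. s 0 = 0 \<and> s m = T \<and> strict_mono_on {..m} s \<and> (\<forall>i<m. s (Suc i) - s i \<le> T / real (Suc k ^ 2)) \<and>
      s ` {..m} = J \<union> (\<lambda>i. T * real i / real (Suc k ^ 2)) ` {..Suc k ^ 2} \<and> m \<le> card J + Suc k ^ 2" for k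
    by (rule time_grid_exists[OF T J, of "Suc k ^ 2"]) (simp, blast)
  then obtain s m where sm: "\<And>k. s k 0 = 0" "\<And>k. s k (m k) = T" "\<And>k. strict_mono_on {..m k} (s k)"
    "\<And>k i. i < m k \<Longrightarrow> s k (Suc i) - s k i \<le> T / real (Suc k ^ 2)"
    "\<And>k. s k ` {..m k} = J \<union> (\<lambda>i. T * real i / real (Suc k ^ 2)) ` {..Suc k ^ 2}"
    "\<And>k. m k \<le> card J + Suc k ^ 2"
    by metis
  define D where "D k = s k ` {..m k}" for k
  have D: "(\<lambda>i. T * real i / real (Suc k ^ 2)) ` {..Suc k ^ 2} \<subseteq> D k" "J \<subseteq> D k" "D k \<subseteq> {0..T}" "finite (D k)" for k
    using J T by (auto simp: D_def sm(5) field_simps mult_left_mono simp del: of_nat_power)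
  define a where "a k = (\<integral>\<omega>. ?G \<omega> * of_bool (\<exists>r\<in>D k. \<not> ?W (V r \<omega>)) \<partial>M)" for k
  define H4 where "H4 = (\<integral>\<omega>. ?h (V T \<omega>) ^ 4 \<partial>M)"
  have D_meas: "(\<lambda>\<omega>. of_bool (\<exists>r\<in>D k. \<not> ?W (V r \<omega>)) :: real) \<in> borel_measurable M" for k
  proof -
    have "(\<lambda>\<omega>. \<not> ?W (V r \<omega>)) \<in> M \<rightarrow>\<^sub>M count_space UNIV" if "r \<in> D k" for r
      using D(3)[of k] that
      by (intro walks_local_measurable[OF IW, of r "\<lambda>x. \<not> ?W x"]
            arg_cong[where f = Not] weyl_chamber_rvec_cong) auto
    then have "(\<lambda>\<omega>. \<exists>r\<in>D k. \<not> ?W (V r \<omega>)) \<in> M \<rightarrow>\<^sub>M count_space UNIV"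
      using D(4)[of k] by (intro pred_intros_finite) auto
    then show ?thesis
      by (rule measurable_compose) simp
  qed
  have lim: "a \<longlonglongrightarrow> (\<integral>\<omega>. ?G \<omega> * of_bool (exits_by N V T \<omega>) \<partial>M)"
    unfolding a_def
  proof (rule integral_dominated_convergence[where w = "\<lambda>\<omega>. \<bar>?h (V T \<omega>)\<bar>"])
    show "(\<lambda>\<omega>. ?G \<omega> * of_bool (exits_by N V T \<omega>)) \<in> borel_measurable M"
      using G_meas exits_by_measurable[OF IW T] by (rule borel_measurable_times)
    show "(\<lambda>\<omega>. ?G \<omega> * of_bool (\<exists>r\<in>D k. \<not> ?W (V r \<omega>))) \<in> borel_measurable M" for k
      using G_meas D_meas by (rule borel_measurable_times)
    show "integrable M (\<lambda>\<omega>. \<bar>?h (V T \<omega>)\<bar>)"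
      using integrable_h_weyl_power[OF IW T, of 1] by simp
    show "AE \<omega> in M. (\<lambda>k. ?G \<omega> * of_bool (\<exists>r\<in>D k. \<not> ?W (V r \<omega>))) \<longlonglongrightarrow> ?G \<omega> * of_bool (exits_by N V T \<omega>)"
      using grid_detects_exit[OF IW _ T D(1,3)] by (intro AE_I2 tendsto_mult_left) auto
    show "AE \<omega> in M. norm (?G \<omega> * of_bool (\<exists>r\<in>D k. \<not> ?W (V r \<omega>))) \<le> \<bar>?h (V T \<omega>)\<bar>" for k
      using G_bound by (intro AE_I2) (simp add: of_bool_def)
  qed
  have bound: "\<bar>a k\<bar> \<le> (real (card J) + (real k + 1)\<^sup>2) * ((double_jump_const N T * T\<^sup>2 + H4) / (real k + 1) ^ 3)" for k
  proof -
    \<comment> \<open>the grid times outside \<open>J\<close> only serve to detect the exit; they get the factor \<open>1\<close>\<close>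
    define f where "f i = (if s k i \<in> J then g (s k i) else (\<lambda>_. 1))" for i
    have inj: "inj_on (s k) {..m k}"
      using sm(3)[of k] by (rule strict_mono_on_imp_inj_on)
    have prod: "(\<Prod>i\<le>m k. f i (V (s k i) \<omega>)) = (\<Prod>r\<in>J. g r (V r \<omega>))" for \<omega>
    proof -
      have "(\<Prod>i\<le>m k. f i (V (s k i) \<omega>)) = (\<Prod>r\<in>D k. if r \<in> J then g r (V r \<omega>) else 1)"
        unfolding D_def prod.reindex[OF inj] by (intro prod.cong) (auto simp: f_def)
      also have "\<dots> = (\<Prod>r\<in>J. g r (V r \<omega>))"
        using D(2,4)[of k] by (simp add: prod.inter_restrict[symmetric] Int_absorb1)
      finally show ?thesis .
    qed
    have l: "0 < real k + 1"
      by simp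
    have "\<bar>\<integral>\<omega>. (\<Prod>i\<le>m k. f i (V (s k i) \<omega>)) * ?h (V T \<omega>) * of_bool (\<exists>i\<le>m k. \<not> ?W (V (s k i) \<omega>)) \<partial>M\<bar>
      \<le> real (m k) * ((real k + 1) * (double_jump_const N T * (T / real (Suc k ^ 2))\<^sup>2) + H4 / (real k + 1) ^ 3)"
      unfolding H4_def
    proof (rule skeleton_exit_bound[OF IW N u])
      show "s k i \<le> s k (Suc i)" if "i < m k" for i
        using strict_mono_onD[OF sm(3)[of k], of i "Suc i"] that by simp
      show "\<bar>f i x\<bar> \<le> 1" for i x
        using g1 by (simp add: f_def)
      show "symmetric_fn N (f i)" for i
        using gsym by (simp add: f_def) (simp add: symmetric_fn_def)
    qed (use sm l in auto)
    moreover have "(\<exists>i\<le>m k. \<not> ?W (V (s k i) \<omega>)) \<longleftrightarrow> (\<exists>r\<in>D k. \<not> ?W (V r \<omega>))" for \<omega>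
      by (auto simp: D_def)
    ultimately have "\<bar>a k\<bar> \<le> real (m k) *
        ((real k + 1) * (double_jump_const N T * (T / real (Suc k ^ 2))\<^sup>2) + H4 / (real k + 1) ^ 3)"
      by (simp add: a_def prod)
    also have "(real k + 1) * (double_jump_const N T * (T / real (Suc k ^ 2))\<^sup>2) + H4 / (real k + 1) ^ 3 =
        (double_jump_const N T * T\<^sup>2 + H4) / (real k + 1) ^ 3"
    proof -
      define z where "z = real k + 1"
      have z: "z \<noteq> 0" "real (Suc k ^ 2) = z ^ 2"
        by (auto simp: z_def add.commute)
      show ?thesis
        unfolding z(2) z_def[symmetric] using z(1) by (simp add: field_simps power2_eq_square power3_eq_cube)
    qed
    also have "real (m k) * \<dots> \<le> (real (card J) + (real k + 1)\<^sup>2) * \<dots>"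
    proof (rule mult_right_mono)
      have "real (m k) \<le> real (card J + Suc k ^ 2)"
        using sm(6)[of k] by (simp only: of_nat_le_iff)
      then show "real (m k) \<le> real (card J) + (real k + 1)\<^sup>2"
        by (simp add: add.commute)
      show "0 \<le> (double_jump_const N T * T\<^sup>2 + H4) / (real k + 1) ^ 3"
        using T by (auto simp: double_jump_const_def H4_def intro!: add_nonneg_nonneg divide_nonneg_nonneg mult_nonneg_nonneg)
    qed
    finally show ?thesis .
  qed
  have "(\<lambda>k. (real (card J) + (real k + 1)\<^sup>2) * ((double_jump_const N T * T\<^sup>2 + H4) / (real k + 1) ^ 3)) \<longlonglongrightarrow> 0"
    by real_asymp
  then have "a \<longlonglongrightarrow> 0"
    by (rule Lim_null_comparison[rotated]) (use bound in auto)
  with lim show ?thesis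
    by (rule LIMSEQ_unique)
qed

section \<open>Functionals of the unlabelled path\<close>

text \<open>
  The sets that do not distinguish two paths agreeing up to time \<open>t\<close> form a sigma-algebra containing the
  generators of the history; apply this to a level set of \<open>F\<close>.
\<close>

lemma unlabelled_history_cong:
  assumes F: "F \<in> borel_measurable (unlabelled_history t)" and pq: "\<And>s. 0 \<le> s \<Longrightarrow> s \<le> t \<Longrightarrow> p s = q s"
  shows "F p = (F q :: 'c::t1_space)"
proof -
  have "p \<in> A \<longleftrightarrow> q \<in> A" if "A \<in> sets (unlabelled_history t)" for A
    using that unfolding unlabelled_history_def sets_history
    by (induction rule: sigma_sets.induct) (use pq in auto)
  moreover have "F -` {F p} \<inter> space (unlabelled_history t) \<in> sets (unlabelled_history t)"
    using F by (rule measurable_sets) simp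
  ultimately have "p \<in> F -` {F p} \<inter> space (unlabelled_history t) \<longleftrightarrow>
      q \<in> F -` {F p} \<inter> space (unlabelled_history t)"
    by blast
  then show ?thesis
    by (auto simp: unlabelled_history_def)
qed

lemma space_configurations [simp]: "space configurations = UNIV"
  by (simp add: configurations_def space_PiM)

definition configuration_paths :: "real \<Rightarrow> (real \<Rightarrow> configuration) measure" where
  "configuration_paths T = Pi\<^sub>M {0..T} (\<lambda>_. configurations)"

text \<open>
  The history is generated by maps on all paths, whereas measures on a product space are
  determined by cylinder sets.  The product over \<open>{0..T}\<close> consists of extensional paths, and on these the identity
  maps it measurably to the history, which transports the measurability of \<open>F\<close>.
\<close>

lemma measurable_configuration_paths:
  assumes F: "F \<in> unlabelled_history t \<rightarrow>\<^sub>M L" and t: "t \<le> T"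
  shows "F \<in> configuration_paths T \<rightarrow>\<^sub>M L"
proof -
  have "(\<lambda>q. q) \<in> configuration_paths T \<rightarrow>\<^sub>M unlabelled_history t"
    unfolding unlabelled_history_def history_def
  proof (rule measurable_measure_of)
    fix B assume "B \<in> (\<Union>s\<in>{0..t}. {(\<lambda>p. p s) -` A \<inter> UNIV |A. A \<in> sets configurations})"
    then obtain s A where s: "0 \<le> s" "s \<le> t" "A \<in> sets configurations" "B = (\<lambda>p. p s) -` A"
      by auto
    have "(\<lambda>p. p s) \<in> configuration_paths T \<rightarrow>\<^sub>M configurations"
      unfolding configuration_paths_def by (rule measurable_component_singleton) (use s t in auto)
    from measurable_sets[OF this s(3)]
    show "(\<lambda>q. q) -` B \<inter> space (configuration_paths T) \<in> sets (configuration_paths T)"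
      by (simp add: s(4) vimage_def)
  qed auto
  from measurable_compose[OF this F] show ?thesis .
qed

definition configuration_path ::
  "nat \<Rightarrow> real \<Rightarrow> (real \<Rightarrow> nat \<Rightarrow> int) \<Rightarrow> real \<Rightarrow> configuration" where
  "configuration_path N T \<pi> = (\<lambda>s\<in>{0..T}. unlabel N (\<pi> s))"

lemma unlabel_cong: "(\<And>j. j < N \<Longrightarrow> x j = y j) \<Longrightarrow> unlabel N x = unlabel N y"
  unfolding unlabel_def by (intro ext sum.cong) auto

lemma unlabel_permute:
  assumes "p permutes {..<N}"
  shows "unlabel N (x \<circ> p) = unlabel N x"
  unfolding unlabel_def
  by (rule ext) (simp add: sum.permute[OF assms, of "\<lambda>j. indicator {x j} _"] o_def)

lemma configuration_path_measurable:
  "configuration_path N T \<in> labelled_paths N T \<rightarrow>\<^sub>M configuration_paths T"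
  unfolding configuration_path_def labelled_paths_def configuration_paths_def
proof (rule measurable_restrict)
  fix s assume s: "s \<in> {0..T}"
  have "unlabel N \<in> PiM {..<N} (\<lambda>_. count_space UNIV) \<rightarrow>\<^sub>M configurations"
    by (subst count_space_PiM_finite) auto
  then show "(\<lambda>\<pi>. unlabel N (\<pi> s)) \<in>
      Pi\<^sub>M {0..T} (\<lambda>_. Pi\<^sub>M {..<N} (\<lambda>_. count_space UNIV)) \<rightarrow>\<^sub>M configurations"
    by (rule measurable_compose[OF measurable_component_singleton[OF s]])
qed

lemma path_upto_measurable:
  assumes "\<And>s j. 0 \<le> s \<Longrightarrow> j < N \<Longrightarrow> (\<lambda>\<omega>. Y s \<omega> j) \<in> M \<rightarrow>\<^sub>M count_space UNIV"
  shows "path_upto N T Y \<in> M \<rightarrow>\<^sub>M labelled_paths N T"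
  unfolding path_upto_def labelled_paths_def
  by (intro measurable_restrict assms) auto

lemma configuration_path_upto:
  "configuration_path N T (path_upto N T Y \<omega>) = configuration_path N T (\<lambda>s. Y s \<omega>)"
  unfolding configuration_path_def path_upto_def by (intro restrict_ext unlabel_cong) simp

lemma unlabelled_functional_eq:
  assumes "F \<in> borel_measurable (unlabelled_history t)" "t \<le> T"
  shows "F (\<lambda>s. unlabel N (Y s \<omega>)) = (F (configuration_path N T (path_upto N T Y \<omega>)) :: 'c::t1_space)"
  using assms(2) unfolding configuration_path_upto
  by (intro unlabelled_history_cong[OF assms(1)]) (simp add: configuration_path_def)

lemma h_weyl_pos: "x \<in> weyl_chamber N \<Longrightarrow> 0 < h_weyl N x"
  unfolding h_weyl_def by (intro prod_pos) (auto simp: weyl_chamber_def)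

text \<open>
  The positive and the negative part of \<open>D = h (V T) 1(\<tau> \<le> T)\<close>, pushed forward by the unlabelled path,
  are two finite measures.  They agree on cylinder sets by \<open>exit_part_cancels\<close>, hence are equal and give the same
  integral to every \<open>F\<close>.
\<close>

proposition exit_part_cancels_functional:
  fixes F :: "(real \<Rightarrow> configuration) \<Rightarrow> complex"
  assumes IW: "independent_walks N u M V" and N: "1 \<le> N" and u: "rvec u \<in> weyl_chamber N"
    and T: "0 \<le> T"
    and F: "F \<in> borel_measurable (configuration_paths T)" and bnd: "\<And>p. norm (F p) \<le> B"
  defines "D \<equiv> \<lambda>\<omega>. h_weyl N (rvec (V T \<omega>)) * of_bool (exits_by N V T \<omega>)"
  shows "integrable M (\<lambda>\<omega>. D \<omega> *\<^sub>R F (configuration_path N T (path_upto N T V \<omega>)))"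
    and "(\<integral>\<omega>. D \<omega> *\<^sub>R F (configuration_path N T (path_upto N T V \<omega>)) \<partial>M) = 0"
proof -
  interpret prob_space M
    using IW by (simp add: independent_walks_def)
  let ?P = "configuration_paths T"
  define \<Xi> where "\<Xi> \<omega> = configuration_path N T (path_upto N T V \<omega>)" for \<omega>
  have \<Xi>[measurable]: "\<Xi> \<in> M \<rightarrow>\<^sub>M ?P"
    unfolding \<Xi>_def
    by (rule measurable_compose[OF path_upto_measurable[OF independent_walks_measurable[OF IW]] configuration_path_measurable])
  have D_meas[measurable]: "D \<in> borel_measurable M"
    unfolding D_def using h_weyl_measurable[OF IW T] exits_by_measurable[OF IW T] by (rule borel_measurable_times)
  have D_int: "integrable M D"
  proof (rule Bochner_Integration.integrable_bound)
    show "integrable M (\<lambda>\<omega>. h_weyl N (rvec (V T \<omega>)))"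
      using integrable_h_weyl_power[OF IW T, of 1] by simp
    show "D \<in> borel_measurable M"
      by fact
  qed (auto simp: D_def)
  define d where "d b \<omega> = (if b then max (D \<omega>) 0 else max (- D \<omega>) 0)" for b \<omega>
  have d_meas[measurable]: "d b \<in> borel_measurable M" for b
    unfolding d_def by measurable
  have d_nonneg: "0 \<le> d b \<omega>" for b \<omega>
    by (simp add: d_def)
  have d_int: "integrable M (d b)" for b
    using D_int unfolding d_def by (cases b) auto
  have D_d: "D \<omega> = d True \<omega> - d False \<omega>" for \<omega>
    by (simp add: d_def)
  define \<nu> where "\<nu> b = distr (density M (\<lambda>\<omega>. ennreal (d b \<omega>))) ?P \<Xi>" for b
  have \<nu>_sets: "sets (\<nu> b) = sets ?P" for b
    by (simp add: \<nu>_def)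
  have \<nu>_emeasure: "emeasure (\<nu> b) A = ennreal (\<integral>\<omega>. d b \<omega> * indicator A (\<Xi> \<omega>) \<partial>M)" if A: "A \<in> sets ?P" for A b
  proof -
    have "emeasure (\<nu> b) A = emeasure (density M (\<lambda>\<omega>. ennreal (d b \<omega>))) (\<Xi> -` A \<inter> space M)"
      unfolding \<nu>_def using A by (subst emeasure_distr) auto
    also have "\<dots> = (\<integral>\<^sup>+\<omega>. ennreal (d b \<omega>) * indicator (\<Xi> -` A \<inter> space M) \<omega> \<partial>M)"
      using A by (intro emeasure_density) auto
    also have "\<dots> = (\<integral>\<^sup>+\<omega>. ennreal (d b \<omega> * indicator A (\<Xi> \<omega>)) \<partial>M)"
      by (intro nn_integral_cong) (auto simp: indicator_def)
    also have "\<dots> = ennreal (\<integral>\<omega>. d b \<omega> * indicator A (\<Xi> \<omega>) \<partial>M)"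
    proof (rule nn_integral_eq_integral)
      show "integrable M (\<lambda>\<omega>. d b \<omega> * indicator A (\<Xi> \<omega>))"
        by (rule Bochner_Integration.integrable_bound[OF d_int[of b]]) (use A in \<open>auto simp: indicator_def\<close>)
    qed (simp add: d_nonneg)
    finally show ?thesis .
  qed
  have "\<nu> True = \<nu> False"
  proof (rule measure_eqI_PiM_infinite[where I = "{0..T}" and M = "\<lambda>_. configurations"])
    fix A J assume J: "finite J" "J \<subseteq> {0..T}" and A: "\<And>r. r \<in> J \<Longrightarrow> A r \<in> sets configurations"
    let ?E = "prod_emb {0..T} (\<lambda>_. configurations) J (Pi\<^sub>E J A)"
    have E: "?E \<in> sets ?P"
      unfolding configuration_paths_def using J A by (intro sets_PiM_I) auto
    define g where "g r x = (indicator (A r) (unlabel N x) :: real)" for r x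
    have ind: "indicator ?E (\<Xi> \<omega>) = (\<Prod>r\<in>J. g r (V r \<omega>))" for \<omega>
    proof -
      have "\<Xi> \<omega> \<in> ?E \<longleftrightarrow> (\<forall>r\<in>J. unlabel N (V r \<omega>) \<in> A r)"
        using J(2) unfolding \<Xi>_def configuration_path_upto unfolding configuration_path_def
        by (auto simp: prod_emb_def PiE_iff subset_eq)
      then show ?thesis
        using J(1) by (auto simp: g_def indicator_def prod_zero_iff)
    qed
    have int: "integrable M (\<lambda>\<omega>. d b \<omega> * indicator ?E (\<Xi> \<omega>))" for b
      by (rule Bochner_Integration.integrable_bound[OF d_int[of b]]) (use E in \<open>auto simp: indicator_def\<close>)
    have "(\<integral>\<omega>. d True \<omega> * indicator ?E (\<Xi> \<omega>) \<partial>M) - (\<integral>\<omega>. d False \<omega> * indicator ?E (\<Xi> \<omega>) \<partial>M) =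
        (\<integral>\<omega>. (\<Prod>r\<in>J. g r (V r \<omega>)) * h_weyl N (rvec (V T \<omega>)) * of_bool (exits_by N V T \<omega>) \<partial>M)"
      using int[of True] int[of False]
      by (subst Bochner_Integration.integral_diff[symmetric])
         (auto simp: ind D_d[symmetric] left_diff_distrib[symmetric] D_def mult_ac)
    also have "\<dots> = 0"
    proof (rule exit_part_cancels[OF IW N u T J])
      show "symmetric_fn N (g r)" for r
        unfolding symmetric_fn_def g_def
        by (intro conjI allI impI arg_cong[where f = "indicator (A r)"] unlabel_permute unlabel_cong) auto
    qed (simp add: g_def indicator_def)
    finally show "emeasure (\<nu> True) ?E = emeasure (\<nu> False) ?E"
      by (simp add: \<nu>_emeasure[OF E])
  next
    show "finite_measure (\<nu> True)"
    proof (rule finite_measureI)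
      have "space (\<nu> True) = space ?P"
        by (simp add: \<nu>_def)
      then show "emeasure (\<nu> True) (space (\<nu> True)) \<noteq> \<infinity>"
        using \<nu>_emeasure[of "space ?P" True] by simp
    qed
  qed (simp_all add: \<nu>_sets configuration_paths_def)
  have \<nu>_integral: "(\<integral>p. F p \<partial>\<nu> b) = (\<integral>\<omega>. d b \<omega> *\<^sub>R F (\<Xi> \<omega>) \<partial>M)" for b
    unfolding \<nu>_def using F
    by (subst integral_distr) (auto simp: d_nonneg intro!: integral_density)
  have F_int: "integrable M (\<lambda>\<omega>. d b \<omega> *\<^sub>R F (\<Xi> \<omega>))" for b
  proof (rule Bochner_Integration.integrable_bound)
    show "integrable M (\<lambda>\<omega>. B * d b \<omega>)"
      using d_int by simp
    show "(\<lambda>\<omega>. d b \<omega> *\<^sub>R F (\<Xi> \<omega>)) \<in> borel_measurable M"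
      using measurable_compose[OF \<Xi> F] by simp
    show "AE \<omega> in M. norm (d b \<omega> *\<^sub>R F (\<Xi> \<omega>)) \<le> norm (B * d b \<omega>)"
    proof (rule AE_I2)
      fix \<omega>
      have "d b \<omega> * norm (F (\<Xi> \<omega>)) \<le> d b \<omega> * B"
        using bnd by (intro mult_left_mono d_nonneg)
      also have "\<dots> \<le> \<bar>B * d b \<omega>\<bar>"
        by (simp add: mult.commute)
      finally show "norm (d b \<omega> *\<^sub>R F (\<Xi> \<omega>)) \<le> norm (B * d b \<omega>)"
        by (simp add: d_nonneg)
    qed
  qed
  have split: "D \<omega> *\<^sub>R F (\<Xi> \<omega>) = d True \<omega> *\<^sub>R F (\<Xi> \<omega>) - d False \<omega> *\<^sub>R F (\<Xi> \<omega>)" for \<omega>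
    by (simp add: D_d scaleR_left_diff_distrib)
  show "integrable M (\<lambda>\<omega>. D \<omega> *\<^sub>R F (configuration_path N T (path_upto N T V \<omega>)))"
    unfolding \<Xi>_def[symmetric] split using F_int by simp
  show "(\<integral>\<omega>. D \<omega> *\<^sub>R F (configuration_path N T (path_upto N T V \<omega>)) \<partial>M) = 0"
    unfolding \<Xi>_def[symmetric] split
    using F_int \<open>\<nu> True = \<nu> False\<close> by (simp add: \<nu>_integral[symmetric])
qed

text \<open>
  The reweighted law of \<open>X\<close> is prescribed on labelled paths up to \<open>T\<close>, through which \<open>F\<close> factors; the
  density is the one of the Doob transform once \<open>\<tau> > T\<close> is expressed by \<open>exits_by\<close>.
\<close>

proposition noncolliding_walk_expectation:
  fixes F :: "(real \<Rightarrow> configuration) \<Rightarrow> complex"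
  assumes IW: "independent_walks N u M V" and NW: "noncolliding_walk N u M V M' X"
    and u: "rvec u \<in> weyl_chamber N" and T: "0 \<le> T"
    and F: "F \<in> borel_measurable (configuration_paths T)"
  shows "(\<integral>\<omega>. F (configuration_path N T (path_upto N T X \<omega>)) \<partial>M') =
    (\<integral>\<omega>. (of_bool (\<not> exits_by N V T \<omega>) * (h_weyl N (rvec (V T \<omega>)) / h_weyl N (rvec u))) *\<^sub>R
       F (configuration_path N T (path_upto N T V \<omega>)) \<partial>M)"
proof -
  define \<rho> where "\<rho> \<omega> = of_bool (\<not> exits_by N V T \<omega>) * (h_weyl N (rvec (V T \<omega>)) / h_weyl N (rvec u))" for \<omega>
  have X: "path_upto N T X \<in> M' \<rightarrow>\<^sub>M labelled_paths N T"
    using NW by (intro path_upto_measurable) (auto simp: noncolliding_walk_def)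
  have V: "path_upto N T V \<in> M \<rightarrow>\<^sub>M labelled_paths N T"
    by (rule path_upto_measurable[OF independent_walks_measurable[OF IW]])
  have G: "(\<lambda>\<pi>. F (configuration_path N T \<pi>)) \<in> borel_measurable (labelled_paths N T)"
    by (rule measurable_compose[OF configuration_path_measurable F])
  have \<rho>_meas: "\<rho> \<in> borel_measurable M"
  proof -
    have "(\<lambda>\<omega>. (1 - of_bool (exits_by N V T \<omega>)) * (h_weyl N (rvec (V T \<omega>)) / h_weyl N (rvec u))) \<in> borel_measurable M"
      using h_weyl_measurable[OF IW T] exits_by_measurable[OF IW T]
      by (intro borel_measurable_times borel_measurable_diff borel_measurable_divide) auto
    also have "(\<lambda>\<omega>. (1 - of_bool (exits_by N V T \<omega>)) * (h_weyl N (rvec (V T \<omega>)) / h_weyl N (rvec u))) = \<rho>"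
      by (auto simp: \<rho>_def)
    finally show ?thesis .
  qed
  have \<rho>_nonneg: "0 \<le> \<rho> \<omega>" for \<omega>
    using h_weyl_pos[OF u] h_weyl_pos[of "rvec (V T \<omega>)" N] T
    by (auto simp: \<rho>_def exits_by_def less_imp_le)
  have "distr M' (labelled_paths N T) (path_upto N T X) =
      distr (density M (\<lambda>\<omega>. ennreal (of_bool (ereal T < exit_time N V \<omega>) *
        (h_weyl N (rvec (V T \<omega>)) / h_weyl N (rvec u))))) (labelled_paths N T) (path_upto N T V)"
    using NW T by (simp add: noncolliding_walk_def)
  also have "density M (\<lambda>\<omega>. ennreal (of_bool (ereal T < exit_time N V \<omega>) *
        (h_weyl N (rvec (V T \<omega>)) / h_weyl N (rvec u)))) = density M (\<lambda>\<omega>. ennreal (\<rho> \<omega>))"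
    unfolding density_def
    by (intro arg_cong[where f = "measure_of (space M) (sets M)"] ext nn_integral_cong)
       (simp add: \<rho>_def less_exit_time_iff[OF IW _ T])
  finally have law: "distr M' (labelled_paths N T) (path_upto N T X) =
      distr (density M (\<lambda>\<omega>. ennreal (\<rho> \<omega>))) (labelled_paths N T) (path_upto N T V)" .
  have "(\<integral>\<omega>. F (configuration_path N T (path_upto N T X \<omega>)) \<partial>M') =
      (\<integral>\<pi>. F (configuration_path N T \<pi>) \<partial>distr M' (labelled_paths N T) (path_upto N T X))"
    by (rule integral_distr[OF X G, symmetric])
  also have "\<dots> = (\<integral>\<omega>. F (configuration_path N T (path_upto N T V \<omega>)) \<partial>density M (\<lambda>\<omega>. ennreal (\<rho> \<omega>)))"
    unfolding law by (rule integral_distr) (use V G in auto)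
  also have "\<dots> = (\<integral>\<omega>. \<rho> \<omega> *\<^sub>R F (configuration_path N T (path_upto N T V \<omega>)) \<partial>M)"
    by (rule integral_density) (use \<rho>_meas \<rho>_nonneg measurable_compose[OF V G] in auto)
  finally show ?thesis
    by (simp add: \<rho>_def)
qed

section \<open>The determinantal martingale representation\<close>

theorem proposition4p4:
  fixes N :: nat and u :: "nat \<Rightarrow> int"
    and M :: "'a measure" and V :: "real \<Rightarrow> 'a \<Rightarrow> nat \<Rightarrow> int"
    and M' :: "'b measure" and X :: "real \<Rightarrow> 'b \<Rightarrow> nat \<Rightarrow> int"
    and t T :: real
    and F :: "(real \<Rightarrow> configuration) \<Rightarrow> complex"
  assumes "1 \<le> N"
    and "strict_mono_on {..<N} u"
    and "independent_walks N u M V"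
    and "noncolliding_walk N u M V M' X"
    and "0 \<le> t" and "t \<le> T"
    and "F \<in> borel_measurable (unlabelled_history t)"
    and "bounded (range F)"
  shows
    "integrable M (\<lambda>\<omega>. F (\<lambda>s. unlabel N (V s \<omega>)) *
        Determinant.det (mat N N (\<lambda>(j, k). mart N u k T (V T \<omega> j)))) \<and>
     (\<integral>\<omega>. F (\<lambda>s. unlabel N (X s \<omega>)) \<partial>M') =
     (\<integral>\<omega>. F (\<lambda>s. unlabel N (V s \<omega>)) *
        Determinant.det (mat N N (\<lambda>(j, k). mart N u k T (V T \<omega> j))) \<partial>M)"
proof -
  note IW = assms(3)
  have T: "0 \<le> T"
    using assms(5,6) by simp
  have u: "rvec u \<in> weyl_chamber N"
    using strict_mono_onD[OF assms(2)] by (auto simp: weyl_chamber_def rvec_def)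
  obtain B where B: "\<And>p. norm (F p) \<le> B"
    using assms(8) by (auto simp: bounded_iff)
  have F: "F \<in> borel_measurable (configuration_paths T)"
    by (rule measurable_configuration_paths[OF assms(7,6)])
  define H where "H = h_weyl N (rvec u)"
  define Z where "Z \<omega> = F (configuration_path N T (path_upto N T V \<omega>))" for \<omega>
  define h where "h \<omega> = h_weyl N (rvec (V T \<omega>))" for \<omega>
  have FZ: "F (\<lambda>s. unlabel N (V s \<omega>)) = Z \<omega>" for \<omega>
    unfolding Z_def by (rule unlabelled_functional_eq[OF assms(7,6)])
  have Z_meas: "Z \<in> borel_measurable M"
    unfolding Z_def
    by (rule measurable_compose[OF path_upto_measurable[OF independent_walks_measurable[OF IW]]
          measurable_compose[OF configuration_path_measurable F]])
  have integrand: "F (\<lambda>s. unlabel N (V s \<omega>)) *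
      Determinant.det (mat N N (\<lambda>(j, k). mart N u k T (V T \<omega> j))) = (h \<omega> / H) *\<^sub>R Z \<omega>" for \<omega>
    unfolding FZ det_mart_eq_h_ratio[OF assms(2)] by (simp add: h_def H_def scaleR_conv_of_real mult.commute)
  have int: "integrable M (\<lambda>\<omega>. (h \<omega> / H) *\<^sub>R Z \<omega>)"
  proof (rule Bochner_Integration.integrable_bound)
    show "integrable M (\<lambda>\<omega>. B * (h \<omega> / H))"
      using integrable_h_weyl_power[OF IW T, of 1] by (simp add: h_def)
    show "(\<lambda>\<omega>. (h \<omega> / H) *\<^sub>R Z \<omega>) \<in> borel_measurable M"
      using h_weyl_measurable[OF IW T] Z_meas unfolding h_def by measurable
    show "AE \<omega> in M. norm ((h \<omega> / H) *\<^sub>R Z \<omega>) \<le> norm (B * (h \<omega> / H))"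
    proof (rule AE_I2)
      fix \<omega>
      have "\<bar>h \<omega> / H\<bar> * norm (Z \<omega>) \<le> \<bar>h \<omega> / H\<bar> * \<bar>B\<bar>"
        using B by (intro mult_left_mono) (auto simp: Z_def intro: order_trans[OF _ abs_ge_self])
      then show "norm ((h \<omega> / H) *\<^sub>R Z \<omega>) \<le> norm (B * (h \<omega> / H))"
        by (simp add: abs_mult mult.commute)
    qed
  qed
  define D where "D \<omega> = h \<omega> * of_bool (exits_by N V T \<omega>)" for \<omega>
  have DZ: "integrable M (\<lambda>\<omega>. D \<omega> *\<^sub>R Z \<omega>)" "(\<integral>\<omega>. D \<omega> *\<^sub>R Z \<omega> \<partial>M) = 0"
    using exit_part_cancels_functional[OF IW assms(1) u T F B] unfolding D_def h_def Z_def by blast+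
  have "(\<integral>\<omega>. F (\<lambda>s. unlabel N (X s \<omega>)) \<partial>M') = (\<integral>\<omega>. F (configuration_path N T (path_upto N T X \<omega>)) \<partial>M')"
    unfolding unlabelled_functional_eq[OF assms(7,6)] ..
  also have "\<dots> = (\<integral>\<omega>. (of_bool (\<not> exits_by N V T \<omega>) * (h \<omega> / H)) *\<^sub>R Z \<omega> \<partial>M)"
    unfolding noncolliding_walk_expectation[OF IW assms(4) u T F] h_def H_def Z_def ..
  also have "\<dots> = (\<integral>\<omega>. (h \<omega> / H) *\<^sub>R Z \<omega> - (1 / H) *\<^sub>R (D \<omega> *\<^sub>R Z \<omega>) \<partial>M)"
    by (intro Bochner_Integration.integral_cong) (auto simp: D_def)
  also have "\<dots> = (\<integral>\<omega>. (h \<omega> / H) *\<^sub>R Z \<omega> \<partial>M) - (\<integral>\<omega>. (1 / H) *\<^sub>R (D \<omega> *\<^sub>R Z \<omega>) \<partial>M)"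
    by (rule Bochner_Integration.integral_diff[OF int integrable_scaleR_right[OF DZ(1)]])
  also have "\<dots> = (\<integral>\<omega>. (h \<omega> / H) *\<^sub>R Z \<omega> \<partial>M)"
    unfolding integral_scaleR_right DZ(2) by simp
  finally show ?thesis
    using int unfolding integrand by simp
qed

end
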